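(* If $G$ is a precompact metrizable topological group, then $\widehat G$, equipped with the Fell topology, is discrete.
   Context: All topological groups are assumed Hausdorff. A topological group $G$ is precompact if it is isomorphic, as a topological group, to a subgroup of a compact group. A unitary representation of $G$ is a continuous homomorphism $\rho:G\to U(\mathcal H)$, where $\mathcal H$ is a complex Hilbert space and the unitary group $U(\mathcal H)$ carries the strong operator topology. It is irreducible if there is no closed $\rho(G)$-invariant subspace $E$ with $\{0\}\subsetneq E\subsetneq\mathcal H$. The dual object $\widehat G$ is the set of (unitary) equivalence classes of irreducible unitary representations of $G$. For a unitary representation $\rho$ of $G$ on $\mathcal H$, $P_\rho'$ is the set of functions $g\mapsto(\rho(g)v,v)$ on $G$ with $v\in\mathcal H$, and $P_\rho$ is the set of finite sums of elements of $P_\rho'$; these depend only on the equivalence class $[\rho]$. Fell topology on a set $\mathcal R$ of equivalence classes of unitary representations of $G$: the basic neighborhoods of $[\rho]\in\mathcal R$ are the sets $$W(f_1,\dots,f_n,C,\epsilon)=\{[\sigma]\in\mathcal R:\ \exists g_1,\dots,g_n\in P_\sigma\ \ \forall x\in C\ \ \forall i\ \ |f_i(x)-g_i(x)|<\epsilon\},$$ where $f_1,\dots,f_n\in P_\rho$, $C$ is a compact subset of $G$ and $\epsilon>0$. *)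

theory Defs
  imports "HOL-Analysis.Analysis"
begin

text \<open>
  Groups are types of class \<^class>\<open>topological_group_add\<close>. This class is not commutative: its
  additive notation is only notation, with \<open>x + y\<close> for the product and \<open>0\<close> for the unit.
\<close>

subsection \<open>Complex Hilbert spaces\<close>

text \<open>
  The complex inner product is linear in its first argument. The underlying real structure
  (norm, metric, topology) is that of \<^class>\<open>real_inner\<close>, tied to the complex one by the
  third and the last axiom; positive definiteness of \<open>cinner\<close> is thereby inherited.
\<close>

class complex_hilbert_space = real_inner + complete_space +
  fixes scaleC :: "complex \<Rightarrow> 'a \<Rightarrow> 'a"  (infixr \<open>*\<^sub>C\<close> 75)
    and cinner :: "'a \<Rightarrow> 'a \<Rightarrow> complex"
  assumes scaleC_add_right: "a *\<^sub>C (x + y) = a *\<^sub>C x + a *\<^sub>C y"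
    and scaleC_add_left: "(a + b) *\<^sub>C x = a *\<^sub>C x + b *\<^sub>C x"
    and scaleC_of_real: "complex_of_real r *\<^sub>C x = r *\<^sub>R x"
    and scaleC_scaleC: "a *\<^sub>C b *\<^sub>C x = (a * b) *\<^sub>C x"
    and cinner_commute: "cinner x y = cnj (cinner y x)"
    and cinner_add_left: "cinner (x + y) z = cinner x z + cinner y z"
    and cinner_scaleC_left: "cinner (a *\<^sub>C x) y = a * cinner x y"
    and inner_eq_Re_cinner: "inner x y = Re (cinner x y)"

instantiation complex :: complex_hilbert_space
begin

definition scaleC_complex :: "complex \<Rightarrow> complex \<Rightarrow> complex" where
  "scaleC_complex a x = a * x"

definition cinner_complex :: "complex \<Rightarrow> complex \<Rightarrow> complex" where
  "cinner_complex x y = x * cnj y"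

instance
  by standard
    (simp_all add: scaleC_complex_def cinner_complex_def inner_complex_def scaleR_conv_of_real
      algebra_simps)

end

definition closed_csubspace :: "'h::complex_hilbert_space set \<Rightarrow> bool" where
  "closed_csubspace E \<longleftrightarrow>
     closed E \<and> 0 \<in> E \<and> (\<forall>x\<in>E. \<forall>y\<in>E. x + y \<in> E) \<and> (\<forall>c. \<forall>x\<in>E. c *\<^sub>C x \<in> E)"

definition unitary_map ::
    "'h::complex_hilbert_space set \<Rightarrow> 'h set \<Rightarrow> ('h \<Rightarrow> 'h) \<Rightarrow> bool" where
  "unitary_map E F T \<longleftrightarrow>
     bij_betw T E F \<and>
     (\<forall>x\<in>E. \<forall>y\<in>E. T (x + y) = T x + T y) \<and>
     (\<forall>c. \<forall>x\<in>E. T (c *\<^sub>C x) = c *\<^sub>C T x) \<and>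
     (\<forall>x\<in>E. \<forall>y\<in>E. cinner (T x) (T y) = cinner x y)"

text \<open>
  The unitary group of \<open>E\<close> consists of functions that are extensional on \<open>E\<close>, so that
  operators on \<open>E\<close> are equal iff they agree on \<open>E\<close>. The strong operator topology is the
  topology of pointwise convergence on \<open>E\<close> in norm, i.e. a subspace of the product of
  \<open>E\<close>-many copies of the ambient space.
\<close>

definition unitary_group :: "'h::complex_hilbert_space set \<Rightarrow> ('h \<Rightarrow> 'h) set" where
  "unitary_group E = {T \<in> extensional E. unitary_map E E T}"

definition unitary_sot :: "'h::complex_hilbert_space set \<Rightarrow> ('h \<Rightarrow> 'h) topology" where
  "unitary_sot E = subtopology (product_topology (\<lambda>_. euclidean) E) (unitary_group E)"

subsection \<open>Unitary representations and the dual object\<close>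

text \<open>
  A representation is a pair of a Hilbert space and an action on it. Since a set in HOL cannot
  range over all types, the Hilbert spaces are the closed subspaces of one ambient Hilbert space
  \<open>'h\<close>. The type \<open>'h\<close> is left arbitrary, and every Hilbert space is a closed subspace of itself;
  an ambient space of dimension at least \<open>max \<aleph>\<^sub>0 |G|\<close> contains, up to unitary equivalence, all
  irreducible representations of \<open>G\<close>, as these are cyclic.
\<close>

type_synonym ('g, 'h) rep = "'h set \<times> ('g \<Rightarrow> 'h \<Rightarrow> 'h)"

definition unitary_rep ::
    "('g::topological_group_add, 'h::complex_hilbert_space) rep \<Rightarrow> bool" where
  "unitary_rep = (\<lambda>(E, \<rho>).
     closed_csubspace E \<and>
     continuous_map euclidean (unitary_sot E) \<rho> \<and>
     (\<forall>x y. \<rho> (x + y) = compose E (\<rho> x) (\<rho> y)))"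

text \<open>
  The zero space is excluded, as usual. If it were allowed, the only neighbourhood of its class
  would be the whole dual object, because \<open>0\<close> is a function of positive type of every
  representation, and the dual object would not be discrete.
\<close>

definition irreducible_rep ::
    "('g::topological_group_add, 'h::complex_hilbert_space) rep \<Rightarrow> bool" where
  "irreducible_rep = (\<lambda>(E, \<rho>).
     unitary_rep (E, \<rho>) \<and> E \<noteq> {0} \<and>
     \<not> (\<exists>F. closed_csubspace F \<and> (\<forall>g. \<rho> g ` F \<subseteq> F) \<and> {0} \<subset> F \<and> F \<subset> E))"

definition rep_equiv ::
    "('g::topological_group_add, 'h::complex_hilbert_space) rep \<Rightarrow> ('g, 'h) rep \<Rightarrow> bool" where
  "rep_equiv = (\<lambda>(E, \<rho>) (F, \<sigma>).
     \<exists>T. unitary_map E F T \<and> (\<forall>g. \<forall>v\<in>E. T (\<rho> g v) = \<sigma> g (T v)))"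

definition dual_object ::
    "('g::topological_group_add, 'h::complex_hilbert_space) rep set set" where
  "dual_object = {r. irreducible_rep r} //
     {(r, s). irreducible_rep r \<and> irreducible_rep s \<and> rep_equiv r s}"

subsection \<open>The Fell topology\<close>

definition pos_fun' ::
    "('g::topological_group_add, 'h::complex_hilbert_space) rep \<Rightarrow> ('g \<Rightarrow> complex) set" where
  "pos_fun' = (\<lambda>(E, \<rho>). {\<lambda>g. cinner (\<rho> g v) v | v. v \<in> E})"

definition pos_fun ::
    "('g::topological_group_add, 'h::complex_hilbert_space) rep \<Rightarrow> ('g \<Rightarrow> complex) set" where
  "pos_fun r = {\<lambda>g. \<Sum>i<n. p i g | (n::nat) p. \<forall>i<n. p i \<in> pos_fun' r}"

text \<open>
  On a class of equivalent representations the union below is a union of equal sets, by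
  \<open>pos_fun_rep_equiv\<close>.
\<close>

definition pos_fun_class ::
    "('g::topological_group_add, 'h::complex_hilbert_space) rep set \<Rightarrow> ('g \<Rightarrow> complex) set" where
  "pos_fun_class c = (\<Union>r\<in>c. pos_fun r)"

definition fell_nbhd ::
    "('g::topological_group_add, 'h::complex_hilbert_space) rep set set \<Rightarrow>
     nat \<Rightarrow> (nat \<Rightarrow> 'g \<Rightarrow> complex) \<Rightarrow> 'g set \<Rightarrow> real \<Rightarrow> ('g, 'h) rep set set" where
  "fell_nbhd R n f C \<epsilon> =
     {s \<in> R. \<exists>h. (\<forall>i<n. h i \<in> pos_fun_class s) \<and>
                  (\<forall>x\<in>C. \<forall>i<n. cmod (f i x - h i x) < \<epsilon>)}"

definition fell_open ::
    "('g::topological_group_add, 'h::complex_hilbert_space) rep set set \<Rightarrow>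
     ('g, 'h) rep set set \<Rightarrow> bool" where
  "fell_open R U \<longleftrightarrow> U \<subseteq> R \<and>
     (\<forall>r\<in>U. \<exists>n f C \<epsilon>. (\<forall>i<n. f i \<in> pos_fun_class r) \<and> compact C \<and> \<epsilon> > 0 \<and>
                     fell_nbhd R n f C \<epsilon> \<subseteq> U)"

definition fell_topology ::
    "('g::topological_group_add, 'h::complex_hilbert_space) rep set set \<Rightarrow>
     ('g, 'h) rep set topology" where
  "fell_topology R = topology (fell_open R)"

subsection \<open>Well-definedness\<close>

lemma rep_equiv_refl: "unitary_rep r \<Longrightarrow> rep_equiv r r"
  unfolding rep_equiv_def unitary_map_def
  by (cases r) (auto intro!: exI[of _ id])

lemma unitary_rep_closed:
  assumes "unitary_rep (E, \<rho>)" and "v \<in> E"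
  shows "\<rho> g v \<in> E"
proof -
  have "\<rho> g \<in> unitary_group E"
    using assms(1) unfolding unitary_rep_def unitary_sot_def continuous_map_in_subtopology by auto
  then show ?thesis
    using assms(2) unfolding unitary_group_def unitary_map_def by (auto dest: bij_betwE)
qed

lemma rep_equiv_sym:
  assumes "unitary_rep r" and "unitary_rep s" and "rep_equiv r s"
  shows "rep_equiv s r"
proof -
  obtain E \<rho> F \<sigma> where rs: "r = (E, \<rho>)" "s = (F, \<sigma>)" by (cases r, cases s) auto
  obtain T where T: "unitary_map E F T" and eq: "\<And>g v. v \<in> E \<Longrightarrow> T (\<rho> g v) = \<sigma> g (T v)"
    using assms(3) unfolding rs rep_equiv_def by auto
  define S where "S = inv_into E T"
  have bij: "bij_betw T E F" using T by (simp add: unitary_map_def)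
  have bijS: "bij_betw S F E" unfolding S_def using bij by (rule bij_betw_inv_into)
  have SE: "S y \<in> E" if "y \<in> F" for y using bijS that by (auto dest: bij_betwE)
  have TS: "T (S y) = y" if "y \<in> F" for y
    unfolding S_def using bij that by (rule bij_betw_inv_into_right)
  have ST: "S (T x) = x" if "x \<in> E" for x
    unfolding S_def using bij that by (rule bij_betw_inv_into_left)
  have E: "closed_csubspace E" using assms(1) by (simp add: rs unitary_rep_def)
  have "unitary_map F E S"
    unfolding unitary_map_def
  proof (intro conjI ballI allI)
    show "bij_betw S F E" by fact
  next
    fix x y assume xy: "x \<in> F" "y \<in> F"
    have "S x + S y \<in> E" using E SE xy by (simp add: closed_csubspace_def)
    then have "S x + S y = S (T (S x + S y))" by (simp add: ST)
    also have "T (S x + S y) = x + y" using T SE TS xy by (simp add: unitary_map_def)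
    finally show "S (x + y) = S x + S y" by simp
  next
    fix c x assume x: "x \<in> F"
    have "c *\<^sub>C S x \<in> E" using E SE x by (simp add: closed_csubspace_def)
    then have "c *\<^sub>C S x = S (T (c *\<^sub>C S x))" by (simp add: ST)
    also have "T (c *\<^sub>C S x) = c *\<^sub>C x" using T SE TS x by (simp add: unitary_map_def)
    finally show "S (c *\<^sub>C x) = c *\<^sub>C S x" by simp
  next
    fix x y assume xy: "x \<in> F" "y \<in> F"
    have "cinner (T (S x)) (T (S y)) = cinner (S x) (S y)"
      using T SE xy by (simp add: unitary_map_def)
    then show "cinner (S x) (S y) = cinner x y" using TS xy by simp
  qed
  moreover have "S (\<sigma> g v) = \<rho> g (S v)" if v: "v \<in> F" for g v
  proof -
    have "\<rho> g (S v) \<in> E" using assms(1) SE[OF v] unfolding rs by (rule unitary_rep_closed)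
    then have "S (T (\<rho> g (S v))) = \<rho> g (S v)" by (rule ST)
    then show ?thesis using eq[OF SE[OF v]] TS[OF v] by simp
  qed
  ultimately show ?thesis unfolding rs rep_equiv_def by auto
qed

lemma rep_equiv_trans:
  assumes "rep_equiv r s" and "rep_equiv s t"
  shows "rep_equiv r t"
proof -
  obtain E \<rho> F \<sigma> D \<tau> where rst: "r = (E, \<rho>)" "s = (F, \<sigma>)" "t = (D, \<tau>)"
    by (cases r, cases s, cases t) auto
  obtain T where T: "unitary_map E F T" and eqT: "\<And>g v. v \<in> E \<Longrightarrow> T (\<rho> g v) = \<sigma> g (T v)"
    using assms(1) unfolding rst rep_equiv_def by auto
  obtain S where S: "unitary_map F D S" and eqS: "\<And>g v. v \<in> F \<Longrightarrow> S (\<sigma> g v) = \<tau> g (S v)"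
    using assms(2) unfolding rst rep_equiv_def by auto
  have TF: "T x \<in> F" if "x \<in> E" for x
    using T that unfolding unitary_map_def by (auto dest: bij_betwE)
  have "unitary_map E D (S \<circ> T)"
    using T S TF unfolding unitary_map_def by (auto intro: bij_betw_trans)
  then show ?thesis
    unfolding rst rep_equiv_def using eqT eqS TF by (auto intro!: exI[of _ "S \<circ> T"])
qed

lemma equiv_irreducible_rep:
  "equiv {r :: ('g::topological_group_add, 'h::complex_hilbert_space) rep. irreducible_rep r}
     {(r, s). irreducible_rep r \<and> irreducible_rep s \<and> rep_equiv r s}"
proof -
  have u: "unitary_rep r" if "irreducible_rep r" for r :: "('g, 'h) rep"
    using that by (cases r) (simp add: irreducible_rep_def)
  show ?thesis
    by (rule equivI)
      (auto simp: refl_on_def sym_def trans_def intro: rep_equiv_refl rep_equiv_sym u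
            dest: rep_equiv_trans)
qed

lemma pos_fun_rep_equiv:
  fixes r s :: "('g::topological_group_add, 'h::complex_hilbert_space) rep"
  assumes "unitary_rep r" and "unitary_rep s" and "rep_equiv r s"
  shows "pos_fun r = pos_fun s"
proof -
  have sub: "pos_fun' r \<subseteq> pos_fun' s"
    if r: "unitary_rep r" and rs: "rep_equiv r s" for r s :: "('g, 'h) rep"
  proof -
    obtain E \<rho> F \<sigma> where eqs: "r = (E, \<rho>)" "s = (F, \<sigma>)" by (cases r, cases s) auto
    obtain T where T: "unitary_map E F T" and eq: "\<And>g v. v \<in> E \<Longrightarrow> T (\<rho> g v) = \<sigma> g (T v)"
      using rs unfolding eqs rep_equiv_def by auto
    have "\<exists>w. (\<lambda>g. cinner (\<rho> g v) v) = (\<lambda>g. cinner (\<sigma> g w) w) \<and> w \<in> F" if v: "v \<in> E" for v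
    proof (intro exI conjI ext)
      show "T v \<in> F" using T v unfolding unitary_map_def by (auto dest: bij_betwE)
    next
      fix g
      have "\<rho> g v \<in> E" using r v unfolding eqs by (rule unitary_rep_closed)
      then have "cinner (T (\<rho> g v)) (T v) = cinner (\<rho> g v) v"
        using T v by (simp add: unitary_map_def)
      then show "cinner (\<rho> g v) v = cinner (\<sigma> g (T v)) (T v)" using eq[OF v] by simp
    qed
    then show ?thesis unfolding eqs pos_fun'_def by auto
  qed
  have "pos_fun' r = pos_fun' s"
    using sub[OF assms(1,3)] sub[OF assms(2) rep_equiv_sym[OF assms]] by auto
  then show ?thesis by (simp add: pos_fun_def)
qed

lemma istopology_fell_open:
  fixes R :: "('g::topological_group_add, 'h::complex_hilbert_space) rep set set"
  shows "istopology (fell_open R)"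
  unfolding istopology_def
proof (intro conjI allI impI)
  fix S T assume S: "fell_open R S" and T: "fell_open R T"
  have "\<exists>n f C \<epsilon>. (\<forall>i<n. f i \<in> pos_fun_class r) \<and> compact C \<and> \<epsilon> > 0 \<and>
          fell_nbhd R n f C \<epsilon> \<subseteq> S \<inter> T" if r: "r \<in> S \<inter> T" for r
  proof -
    from S r obtain n f C \<epsilon> where 1: "\<And>i. i < n \<Longrightarrow> f i \<in> pos_fun_class r" "compact C"
      "\<epsilon> > 0" "fell_nbhd R n f C \<epsilon> \<subseteq> S"
      unfolding fell_open_def by blast
    from T r obtain m g D \<delta> where 2: "\<And>i. i < m \<Longrightarrow> g i \<in> pos_fun_class r" "compact D"
      "\<delta> > 0" "fell_nbhd R m g D \<delta> \<subseteq> T"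
      unfolding fell_open_def by blast
    define k where "k i = (if i < n then f i else g (i - n))" for i
    have "fell_nbhd R (n + m) k (C \<union> D) (min \<epsilon> \<delta>) \<subseteq> fell_nbhd R n f C \<epsilon>"
    proof
      fix s assume "s \<in> fell_nbhd R (n + m) k (C \<union> D) (min \<epsilon> \<delta>)"
      then obtain h where s: "s \<in> R" and h: "\<And>i. i < n + m \<Longrightarrow> h i \<in> pos_fun_class s"
        and hc: "\<And>x i. x \<in> C \<union> D \<Longrightarrow> i < n + m \<Longrightarrow> cmod (k i x - h i x) < min \<epsilon> \<delta>"
        unfolding fell_nbhd_def by blast
      have "cmod (f i x - h i x) < \<epsilon>" if "x \<in> C" "i < n" for x i
        using hc[of x i] that by (simp add: k_def)
      then show "s \<in> fell_nbhd R n f C \<epsilon>"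
        unfolding fell_nbhd_def using s h by (auto intro!: exI[of _ h])
    qed
    moreover have "fell_nbhd R (n + m) k (C \<union> D) (min \<epsilon> \<delta>) \<subseteq> fell_nbhd R m g D \<delta>"
    proof
      fix s assume "s \<in> fell_nbhd R (n + m) k (C \<union> D) (min \<epsilon> \<delta>)"
      then obtain h where s: "s \<in> R" and h: "\<And>i. i < n + m \<Longrightarrow> h i \<in> pos_fun_class s"
        and hc: "\<And>x i. x \<in> C \<union> D \<Longrightarrow> i < n + m \<Longrightarrow> cmod (k i x - h i x) < min \<epsilon> \<delta>"
        unfolding fell_nbhd_def by blast
      have "cmod (g i x - h (n + i) x) < \<delta>" if "x \<in> D" "i < m" for x i
        using hc[of x "n + i"] that by (simp add: k_def)
      then show "s \<in> fell_nbhd R m g D \<delta>"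
        unfolding fell_nbhd_def using s h by (auto intro!: exI[of _ "\<lambda>i. h (n + i)"])
    qed
    moreover have "\<forall>i<n + m. k i \<in> pos_fun_class r"
      using 1(1) 2(1) by (auto simp: k_def)
    moreover have "compact (C \<union> D)" using 1(2) 2(2) by (rule compact_Un)
    moreover have "min \<epsilon> \<delta> > 0" using 1(3) 2(3) by simp
    moreover note 1(4) 2(4)
    ultimately have "(\<forall>i<n + m. k i \<in> pos_fun_class r) \<and> compact (C \<union> D) \<and> min \<epsilon> \<delta> > 0 \<and>
        fell_nbhd R (n + m) k (C \<union> D) (min \<epsilon> \<delta>) \<subseteq> S \<inter> T" by auto
    then show ?thesis by blast
  qed
  then show "fell_open R (S \<inter> T)" using S unfolding fell_open_def by blast
next
  fix \<K> assume K: "\<forall>K\<in>\<K>. fell_open R K"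
  then have "\<Union>\<K> \<subseteq> R" unfolding fell_open_def by blast
  moreover have "\<exists>n f C \<epsilon>. (\<forall>i<n. f i \<in> pos_fun_class r) \<and> compact C \<and> \<epsilon> > 0 \<and>
          fell_nbhd R n f C \<epsilon> \<subseteq> \<Union>\<K>" if r: "r \<in> \<Union>\<K>" for r
  proof -
    obtain K where "K \<in> \<K>" "r \<in> K" using r by blast
    with K have "fell_open R K" by blast
    then have "\<exists>n f C \<epsilon>. (\<forall>i<n. f i \<in> pos_fun_class r) \<and> compact C \<and> \<epsilon> > 0 \<and>
        fell_nbhd R n f C \<epsilon> \<subseteq> K"
      using \<open>r \<in> K\<close> unfolding fell_open_def by (elim conjE) (rule bspec)
    moreover have "K \<subseteq> \<Union>\<K>" using \<open>K \<in> \<K>\<close> by (rule Union_upper)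
    ultimately show ?thesis by (meson order_trans)
  qed
  ultimately show "fell_open R (\<Union>\<K>)" unfolding fell_open_def by (intro conjI ballI)
qed

lemma openin_fell_topology: "openin (fell_topology R) U \<longleftrightarrow> fell_open R U"
  unfolding fell_topology_def by (simp add: topology_inverse' istopology_fell_open)

subsection \<open>Embeddings of topological groups\<close>

text \<open>
  An embedding is an isomorphism of topological groups onto its range, a subgroup with the
  subspace topology.
\<close>

definition topological_group_embedding ::
    "('g::topological_group_add \<Rightarrow> 'k::topological_group_add) \<Rightarrow> bool" where
  "topological_group_embedding \<phi> \<longleftrightarrow>
     (\<forall>x y. \<phi> (x + y) = \<phi> x + \<phi> y) \<and> embedding_map euclidean euclidean \<phi>"

end

theory Submission
  imports Defs
begin

text \<open>
  On a precompact group every uniformly continuous function with values in a Banach space has an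
  invariant mean (von Neumann), which replaces the Haar integral of the completion. Means of rank
  one operators are compact intertwiners, so they yield Schur's lemma and the orthogonality
  relations: a function of positive type of an irreducible \<open>\<sigma>\<close> stays at a fixed uniform distance
  from a normalised coefficient \<open>f\<close> of an inequivalent irreducible \<open>\<rho>\<close>.

  To detect this distance on a compact set, one shows that the irreducible representations with a
  function \<open>h\<close> of positive type that satisfies \<open>Re h \<ge> h 0 / 2\<close> on a neighbourhood \<open>U\<close> of the unit
  are equicontinuous: smoothing a vector with a bump function on \<open>U\<close> gives a nonzero vector
  with an orbit map of controlled modulus, and Schur's lemma transfers the control to all vectors.
  Now let \<open>U\<^sub>0 = G, U\<^sub>1, U\<^sub>2, \<dots>\<close> be a decreasing base of neighbourhoods of the unit.
  If \<open>h\<close> is close to \<open>f\<close> on \<open>U\<^sub>n\<^sub>+\<^sub>1\<close> and on a fine finite net of \<open>U\<^sub>n\<close>, which does not depend on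
  \<open>h\<close>, then it is close to \<open>f\<close> on \<open>U\<^sub>n\<close>. The union of these nets and the unit is
  a compact set \<open>C\<close>. A function \<open>h\<close> close to \<open>f\<close> on \<open>C\<close> is close to \<open>f\<close> on some \<open>U\<^sub>n\<close> by continuity,
  hence on \<open>G\<close>, and \<open>\<sigma>\<close> is equivalent to \<open>\<rho>\<close>.
\<close>

subsection \<open>Averages over translates\<close>

definition avg :: "'g::group_add list \<Rightarrow> ('g \<Rightarrow> 'b::real_normed_vector) \<Rightarrow> 'g \<Rightarrow> 'b" where
  "avg xs f x = (\<Sum>a\<leftarrow>xs. f (x + a)) /\<^sub>R real (length xs)"

definition avgl :: "'g::group_add list \<Rightarrow> ('g \<Rightarrow> 'b::real_normed_vector) \<Rightarrow> 'g \<Rightarrow> 'b" where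
  "avgl xs f x = (\<Sum>a\<leftarrow>xs. f (a + x)) /\<^sub>R real (length xs)"

definition has_mean :: "('g::group_add \<Rightarrow> 'b::real_normed_vector) \<Rightarrow> 'b \<Rightarrow> bool" where
  "has_mean f c \<longleftrightarrow> (\<forall>e>0. \<exists>xs. xs \<noteq> [] \<and> (\<forall>x. norm (avg xs f x - c) \<le> e))"

lemma convex_list_avg:
  fixes S :: "'b::real_normed_vector set"
  assumes "convex S" "xs \<noteq> []" "\<And>a. a \<in> set xs \<Longrightarrow> g a \<in> S"
  shows "(\<Sum>a\<leftarrow>xs. g a) /\<^sub>R real (length xs) \<in> S"
proof -
  have "(\<Sum>a\<leftarrow>xs. g a) /\<^sub>R real (length xs) = (\<Sum>i<length xs. (1 / real (length xs)) *\<^sub>R g (xs ! i))"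
    by (simp add: sum_list_sum_nth atLeast0LessThan scaleR_right.sum divide_inverse_commute)
  also have "\<dots> \<in> S"
    using assms by (intro convex_sum) auto
  finally show ?thesis .
qed

lemma avg_in_convex:
  assumes "convex S" "xs \<noteq> []" "\<And>y. f y \<in> S"
  shows "avg xs f x \<in> S"
  unfolding avg_def using assms by (intro convex_list_avg) auto

lemma avgl_in_convex:
  assumes "convex S" "xs \<noteq> []" "\<And>y. f y \<in> S"
  shows "avgl xs f x \<in> S"
  unfolding avgl_def using assms by (intro convex_list_avg) auto

lemma avg_diff: "avg xs (\<lambda>x. f x - g x) x = avg xs f x - avg xs g x"
  by (simp add: avg_def sum_list_subtractf scaleR_diff_right)

lemma avg_add: "avg xs (\<lambda>x. f x + g x) x = avg xs f x + avg xs g x"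
  by (simp add: avg_def sum_list_addf scaleR_add_right)

lemma avg_const: "xs \<noteq> [] \<Longrightarrow> avg xs (\<lambda>_. c) x = c"
  using avg_in_convex[of "{c}" xs "\<lambda>_. c" x] by simp

lemma avgl_diff: "avgl xs (\<lambda>x. f x - g x) x = avgl xs f x - avgl xs g x"
  by (simp add: avgl_def sum_list_subtractf scaleR_diff_right)

lemma norm_avg_le:
  assumes "xs \<noteq> []" "\<And>y. norm (f y) \<le> e"
  shows "norm (avg xs f x) \<le> e"
  using avg_in_convex[of "cball 0 e" xs f x] assms by (auto simp: dist_norm)

lemma norm_avgl_le:
  assumes "xs \<noteq> []" "\<And>y. norm (f y) \<le> e"
  shows "norm (avgl xs f x) \<le> e"
  using avgl_in_convex[of "cball 0 e" xs f x] assms by (auto simp: dist_norm)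

lemma avg_translate: "avg xs (\<lambda>x. f (s + x)) x = avg xs f (s + x)"
  by (simp add: avg_def add.assoc)

lemma sum_list_scaleR: "(\<Sum>a\<leftarrow>xs. r *\<^sub>R g a) = r *\<^sub>R (\<Sum>a\<leftarrow>xs. g a :: 'b::real_vector)"
  by (induction xs) (simp_all add: scaleR_add_right)

lemma sum_list_swap':
  "(\<Sum>a\<leftarrow>xs. \<Sum>b\<leftarrow>ys. g a b) = (\<Sum>b\<leftarrow>ys. \<Sum>a\<leftarrow>xs. g a b :: 'b::comm_monoid_add)"
  by (induction xs) (simp_all add: sum_list_addf)

lemma avgl_avg: "avgl ys (avg xs f) x = avg xs (avgl ys f) x"
  by (simp add: avgl_def avg_def sum_list_scaleR add.assoc sum_list_swap'[of _ ys] mult.commute)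

definition addlists :: "'g::group_add list \<Rightarrow> 'g list \<Rightarrow> 'g list" where
  "addlists xs ys = concat (map (\<lambda>a. map ((+) a) ys) xs)"

lemma avg_avg: "avg xs (avg ys f) x = avg (addlists xs ys) f x"
proof -
  have 1: "length (addlists xs ys) = length xs * length ys"
    unfolding addlists_def by (induction xs) simp_all
  have 2: "(\<Sum>a\<leftarrow>addlists xs ys. f (x + a)) = (\<Sum>a\<leftarrow>xs. \<Sum>b\<leftarrow>ys. f (x + a + b))"
    unfolding addlists_def by (induction xs) (simp_all add: comp_def add.assoc)
  show ?thesis
    unfolding avg_def 1 2 by (simp add: sum_list_scaleR)
qed

lemma addlists_Nil_iff: "addlists xs ys = [] \<longleftrightarrow> xs = [] \<or> ys = []"
  by (auto simp: addlists_def)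

lemma has_mean_closed_convex:
  assumes "has_mean f c" "closed S" "convex S" "\<And>x. f x \<in> S"
  shows "c \<in> S"
proof -
  have "c \<in> closure S"
    unfolding closure_approachable
  proof (intro allI impI)
    fix e :: real assume "e > 0"
    then obtain xs where xs: "xs \<noteq> []" "\<And>x. norm (avg xs f x - c) \<le> e / 2"
      using assms(1) half_gt_zero unfolding has_mean_def by blast
    have "dist (avg xs f 0) c < e"
      using xs(2)[of 0] \<open>e > 0\<close> by (simp add: dist_norm)
    moreover have "avg xs f 0 \<in> S"
      using assms(3,4) xs(1) by (simp add: avg_in_convex)
    ultimately show "\<exists>y\<in>S. dist y c < e" by blast
  qed
  then show ?thesis using assms(2) by simp
qed

lemma has_mean_norm_le:
  assumes "has_mean f c" "\<And>x. norm (f x) \<le> e"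
  shows "norm c \<le> e"
  using has_mean_closed_convex[OF assms(1), of "cball 0 e"] assms(2) by (auto simp: dist_norm)

lemma has_mean_ge:
  fixes f :: "'g::group_add \<Rightarrow> real"
  assumes "has_mean f c" "\<And>x. e \<le> f x"
  shows "e \<le> c"
  using has_mean_closed_convex[OF assms(1), of "{e..}"] assms(2) by auto

lemma has_mean_translate_left:
  assumes "has_mean f c"
  shows "has_mean (\<lambda>x. f (s + x)) c"
  using assms unfolding has_mean_def avg_translate by meson

lemma has_mean_avgl:
  assumes "has_mean f c" "ys \<noteq> []"
  shows "has_mean (avgl ys f) c"
  unfolding has_mean_def
proof (intro allI impI)
  fix e :: real assume "e > 0"
  then obtain xs where xs: "xs \<noteq> []" "\<And>x. norm (avg xs f x - c) \<le> e"
    using assms unfolding has_mean_def by blast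
  have "norm (avg xs (avgl ys f) x - c) \<le> e" for x
  proof -
    have "avgl ys (\<lambda>x. c) x = c"
      using avgl_in_convex[of "{c}" ys "\<lambda>_. c"] assms(2) by auto
    then have "avg xs (avgl ys f) x - c = avgl ys (\<lambda>x. avg xs f x - c) x"
      by (simp add: avgl_diff avgl_avg)
    then show ?thesis using norm_avgl_le[OF assms(2)] xs(2) by metis
  qed
  then show "\<exists>xs. xs \<noteq> [] \<and> (\<forall>x. norm (avg xs (avgl ys f) x - c) \<le> e)"
    using xs(1) by blast
qed

lemma has_mean_of_avg:
  assumes "has_mean (avg xs f) c" "xs \<noteq> []"
  shows "has_mean f c"
  using assms unfolding has_mean_def avg_avg by (metis addlists_Nil_iff)

lemma has_mean_lipschitz_linear_on:
  fixes f :: "'g::group_add \<Rightarrow> 'b::real_normed_vector" and L :: "'b \<Rightarrow> 'c::real_normed_vector"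
  assumes f: "has_mean f c" and F: "subspace F" "closed F" and fF: "\<And>x. f x \<in> F"
    and add: "\<And>x y. x \<in> F \<Longrightarrow> y \<in> F \<Longrightarrow> L (x + y) = L x + L y"
    and scale: "\<And>r x. x \<in> F \<Longrightarrow> L (r *\<^sub>R x) = r *\<^sub>R L x"
    and bound: "\<And>x. x \<in> F \<Longrightarrow> norm (L x) \<le> norm x * B"
  shows "has_mean (\<lambda>x. L (f x)) (L c)"
proof -
  have cF: "c \<in> F"
    using has_mean_closed_convex[OF f F(2) subspace_imp_convex[OF F(1)] fF] .
  have sumF: "(\<Sum>a\<leftarrow>xs. f (x + a)) \<in> F \<and> L (\<Sum>a\<leftarrow>xs. f (x + a)) = (\<Sum>a\<leftarrow>xs. L (f (x + a)))" for xs x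
  proof (induction xs)
    case Nil
    have "L (0 *\<^sub>R c) = 0 *\<^sub>R L c" using scale cF by blast
    then show ?case using F(1) by (simp add: subspace_0)
  qed (auto simp: add fF subspace_add[OF F(1)])
  have avg: "avg xs (\<lambda>x. L (f x)) x = L (avg xs f x)" "avg xs f x \<in> F" for xs x
    unfolding avg_def using sumF[of x xs] by (auto simp: scale subspace_scale[OF F(1)])
  show ?thesis
    unfolding has_mean_def
  proof (intro allI impI)
    fix e :: real assume e: "e > 0"
    define B' where "B' = max B 1"
    have B': "B' > 0" by (simp add: B'_def)
    obtain xs where xs: "xs \<noteq> []" "\<And>x. norm (avg xs f x - c) \<le> e / B'"
      using f e B' unfolding has_mean_def by (meson divide_pos_pos)
    have "norm (avg xs (\<lambda>x. L (f x)) x - L c) \<le> e" for x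
    proof -
      have *: "avg xs f x - c \<in> F" using avg(2) cF F(1) by (simp add: subspace_diff)
      have "L (avg xs f x - c) + L c = L (avg xs f x)"
        using add[OF * cF] by simp
      then have "norm (avg xs (\<lambda>x. L (f x)) x - L c) = norm (L (avg xs f x - c))"
        unfolding avg by (metis add_diff_cancel)
      also have "\<dots> \<le> norm (avg xs f x - c) * B" by (rule bound[OF *])
      also have "\<dots> \<le> norm (avg xs f x - c) * B'" by (simp add: B'_def mult_left_mono)
      also have "\<dots> \<le> e" using xs(2)[of x] B' by (simp add: pos_le_divide_eq)
      finally show ?thesis .
    qed
    then show "\<exists>xs. xs \<noteq> [] \<and> (\<forall>x. norm (avg xs (\<lambda>x. L (f x)) x - L c) \<le> e)"
      using xs(1) by blast
  qed
qed

lemma has_mean_bounded_linear: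
  assumes "bounded_linear L" "has_mean f c"
  shows "has_mean (\<lambda>x. L (f x)) (L c)"
proof -
  interpret bounded_linear L by fact
  obtain K where "\<And>x. norm (L x) \<le> norm x * K" using bounded by blast
  then show ?thesis
    using has_mean_lipschitz_linear_on[OF assms(2), of UNIV L K] by (simp add: add scaleR)
qed

subsection \<open>The invariant mean of a precompact group\<close>

text \<open>
  Uniform continuity for the left and the right uniformity at once. On a precompact group the two
  agree, because conjugates of small elements are uniformly small (\<open>small_conjugates\<close>).
\<close>

definition biuc :: "('g::topological_group_add \<Rightarrow> 'b::real_normed_vector) \<Rightarrow> bool" where
  "biuc f \<longleftrightarrow> (\<forall>e>0. \<exists>V. open V \<and> 0 \<in> V \<and> (\<forall>a b. \<forall>v\<in>V. norm (f (a + v + b) - f (a + b)) \<le> e))"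

lemma biucD:
  assumes "biuc f" "e > 0"
  obtains V where "open V" "0 \<in> V" "\<forall>v\<in>V. \<forall>a b. norm (f (a + v + b) - f (a + b)) \<le> e"
proof -
  obtain V where V: "open V \<and> 0 \<in> V \<and> (\<forall>a b. \<forall>v\<in>V. norm (f (a + v + b) - f (a + b)) \<le> e)"
    using assms unfolding biuc_def by metis
  show thesis by (rule that[of V]) (use V in simp_all)
qed

lemma biuc_avg:
  assumes "biuc f" "xs \<noteq> []"
  shows "biuc (avg xs f)"
  unfolding biuc_def
proof (intro allI impI)
  fix e :: real assume "e > 0"
  obtain V where V: "open V" "0 \<in> V" "\<forall>v\<in>V. \<forall>a b. norm (f (a + v + b) - f (a + b)) \<le> e"
    using biucD[OF assms(1) \<open>e > 0\<close>] .
  have "norm (avg xs f (a + v + b) - avg xs f (a + b)) \<le> e" if "v \<in> V" for a b v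
  proof -
    have 1: "\<And>x. norm (f (a + v + x) - f (a + x)) \<le> e" using V(3) that by blast
    have "avg xs f (a + v + b) - avg xs f (a + b) =
        avg xs (\<lambda>x. f (a + v + x) - f (a + x)) b"
      by (simp add: avg_def sum_list_subtractf scaleR_diff_right add.assoc)
    then show ?thesis using norm_avg_le[OF assms(2) 1] by simp
  qed
  then show "\<exists>V. open V \<and> 0 \<in> V \<and> (\<forall>a b. \<forall>v\<in>V. norm (avg xs f (a + v + b) - avg xs f (a + b)) \<le> e)"
    using V by (intro exI[of _ V]) simp
qed

lemma biuc_uminus:
  assumes "biuc f"
  shows "biuc (\<lambda>x. f (- x))"
  unfolding biuc_def
proof (intro allI impI)
  fix e :: real assume "e > 0"
  obtain V where V: "open V" "0 \<in> V" "\<forall>v\<in>V. \<forall>a b. norm (f (a + v + b) - f (a + b)) \<le> e"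
    using biucD[OF assms(1) \<open>e > 0\<close>] .
  have "norm (f (- (a + v + b)) - f (- (a + b))) \<le> e" if "v \<in> uminus -` V" for a b v
    using V(3)[rule_format, of "- v" "- b" "- a"] that by (simp add: minus_add add.assoc)
  moreover have "open (uminus -` V)"
    by (intro open_vimage V(1) continuous_intros)
  ultimately show "\<exists>V. open V \<and> 0 \<in> V \<and> (\<forall>a b. \<forall>v\<in>V. norm (f (- (a + v + b)) - f (- (a + b))) \<le> e)"
    using V(2) by (intro exI[of _ "uminus -` V"]) auto
qed

lemma biuc_translate:
  assumes "biuc f"
  shows "biuc (\<lambda>x. f (s + x + t))"
  unfolding biuc_def
proof (intro allI impI)
  fix e :: real assume "e > 0"
  obtain V where V: "open V" "0 \<in> V" "\<forall>v\<in>V. \<forall>a b. norm (f (a + v + b) - f (a + b)) \<le> e"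
    using biucD[OF assms(1) \<open>e > 0\<close>] .
  have "norm (f (s + (a + v + b) + t) - f (s + (a + b) + t)) \<le> e" if "v \<in> V" for a b v
    using V(3)[rule_format, OF that, of "s + a" "b + t"] by (simp add: add.assoc)
  with V show "\<exists>V. open V \<and> 0 \<in> V \<and> (\<forall>a b. \<forall>v\<in>V. norm (f (s + (a + v + b) + t) - f (s + (a + b) + t)) \<le> e)"
    by (intro exI[of _ V]) simp
qed

lemma biuc_comp2:
  fixes f :: "'g::topological_group_add \<Rightarrow> 'a::real_normed_vector" and g :: "'g \<Rightarrow> 'b::real_normed_vector"
    and h :: "'g \<Rightarrow> 'c::real_normed_vector"
  assumes f: "biuc f" and g: "biuc g"
    and h: "\<And>x y. norm (h x - h y) \<le> A * norm (f x - f y) + B * norm (g x - g y)"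
  shows "biuc h"
  unfolding biuc_def
proof (intro allI impI)
  fix e :: real assume e: "e > 0"
  define C where "C = \<bar>A\<bar> + \<bar>B\<bar> + 1"
  have C: "C > 0" by (simp add: C_def)
  obtain V where V: "open V" "0 \<in> V" "\<forall>v\<in>V. \<forall>a b. norm (f (a + v + b) - f (a + b)) \<le> e / C"
    using biucD[OF f divide_pos_pos[OF e C]] .
  obtain W where W: "open W" "0 \<in> W" "\<forall>v\<in>W. \<forall>a b. norm (g (a + v + b) - g (a + b)) \<le> e / C"
    using biucD[OF g divide_pos_pos[OF e C]] .
  have "norm (h (a + v + b) - h (a + b)) \<le> e" if v: "v \<in> V \<inter> W" for a b v
  proof -
    have "norm (h (a + v + b) - h (a + b)) \<le>
        A * norm (f (a + v + b) - f (a + b)) + B * norm (g (a + v + b) - g (a + b))" by (rule h)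
    also have "\<dots> \<le> \<bar>A\<bar> * norm (f (a + v + b) - f (a + b)) + \<bar>B\<bar> * norm (g (a + v + b) - g (a + b))"
      by (intro add_mono mult_right_mono) auto
    also have "\<dots> \<le> \<bar>A\<bar> * (e / C) + \<bar>B\<bar> * (e / C)"
      using v by (intro add_mono mult_left_mono V(3)[rule_format] W(3)[rule_format]) auto
    also have "\<dots> \<le> C * (e / C)"
      using e C by (simp only: distrib_right[symmetric] C_def) (intro mult_right_mono, auto)
    finally show ?thesis using C by simp
  qed
  then show "\<exists>V. open V \<and> 0 \<in> V \<and> (\<forall>a b. \<forall>v\<in>V. norm (h (a + v + b) - h (a + b)) \<le> e)"
    using V W by (intro exI[of _ "V \<inter> W"]) auto
qed

lemma biuc_bounded_linear:
  assumes "bounded_linear L" "biuc f"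
  shows "biuc (\<lambda>x. L (f x))"
proof -
  interpret bounded_linear L by fact
  obtain K where K: "\<And>x. norm (L x) \<le> norm x * K" using bounded by blast
  have "norm (L (f x) - L (f y)) \<le> K * norm (f x - f y) + 0 * norm (f x - f y)" for x y
    using K[of "f x - f y"] by (simp add: diff mult.commute)
  then show ?thesis by (rule biuc_comp2[OF assms(2) assms(2)])
qed

lemma biuc_add:
  assumes "biuc f" "biuc g"
  shows "biuc (\<lambda>x. f x + g x)"
proof (rule biuc_comp2[OF assms])
  show "norm (f x + g x - (f y + g y)) \<le> 1 * norm (f x - f y) + 1 * norm (g x - g y)" for x y
    using norm_diff_triangle_ineq[of "f x" "g x" "f y" "g y"] by simp
qed

lemma biuc_sum:
  fixes f :: "'i \<Rightarrow> 'g::topological_group_add \<Rightarrow> 'b::real_normed_vector"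
  assumes "\<And>i. i \<in> I \<Longrightarrow> biuc (f i)"
  shows "biuc (\<lambda>x. \<Sum>i\<in>I. f i x)"
  using assms
proof (induction I rule: infinite_finite_induct)
  case (insert i I)
  then show ?case using biuc_add[of "f i" "\<lambda>x. \<Sum>i\<in>I. f i x"] by simp
qed (auto simp: biuc_def intro!: exI[of _ UNIV])

lemma biuc_bilinear:
  assumes prod: "bounded_bilinear mul" and f: "biuc f" "\<And>x. norm (f x) \<le> A" and g: "biuc g" "\<And>x. norm (g x) \<le> B"
  shows "biuc (\<lambda>x. mul (f x) (g x))"
proof -
  interpret bounded_bilinear mul by fact
  obtain K where K: "K > 0" "\<And>a b. norm (mul a b) \<le> norm a * norm b * K" using pos_bounded by blast
  have "norm (mul (f x) (g x) - mul (f y) (g y)) \<le> (B * K) * norm (f x - f y) + (A * K) * norm (g x - g y)" for x y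
  proof -
    have "mul (f x) (g x) - mul (f y) (g y) = mul (f x - f y) (g x) + mul (f y) (g x - g y)"
      by (simp add: diff_left diff_right)
    also have "norm \<dots> \<le> norm (f x - f y) * norm (g x) * K + norm (f y) * norm (g x - g y) * K"
      by (intro norm_triangle_mono K)
    also have "\<dots> \<le> norm (f x - f y) * B * K + A * norm (g x - g y) * K"
      using K(1) by (intro add_mono mult_right_mono mult_left_mono f g) auto
    finally show ?thesis by (simp add: algebra_simps)
  qed
  then show ?thesis by (rule biuc_comp2[OF f(1) g(1)])
qed

lemma biuc_continuous:
  assumes "biuc f" "e > 0"
  obtains V where "open V" "0 \<in> V" "\<forall>v\<in>V. \<forall>x. norm (f (x + v) - f x) \<le> e"
proof -
  obtain V where V: "open V" "0 \<in> V" "\<forall>v\<in>V. \<forall>a b. norm (f (a + v + b) - f (a + b)) \<le> e"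
    using biucD[OF assms] .
  show thesis
    by (rule that[of V]) (use V V(3)[rule_format, where b = 0] in simp_all)
qed

locale precompact_group =
  fixes \<phi> :: "'g::{topological_group_add, t2_space} \<Rightarrow> 'k::{topological_group_add, t2_space}"
  assumes compact: "compact (UNIV :: 'k set)"
    and embedding: "topological_group_embedding \<phi>"
begin

lemma hom_add: "\<phi> (x + y) = \<phi> x + \<phi> y"
  using embedding by (simp add: topological_group_embedding_def)

lemma hom_zero: "\<phi> 0 = 0"
  using hom_add[of 0 0] add_left_cancel[of "\<phi> 0" "\<phi> 0" 0] by simp

lemma hom_minus: "\<phi> (- x) = - \<phi> x"
  using hom_add[of x "- x"] hom_zero by (metis add.right_inverse minus_unique)

lemma cont_hom: "continuous_on UNIV \<phi>"
  using embedding unfolding topological_group_embedding_def embedding_map_def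
  by (auto dest!: homeomorphic_imp_continuous_map simp: continuous_map_in_subtopology)

lemma nbhd_extends:
  assumes "open U" "0 \<in> U"
  obtains W where "open W" "0 \<in> W" "\<phi> -` W \<subseteq> U"
proof -
  have h: "homeomorphic_map euclidean (subtopology euclidean (range \<phi>)) \<phi>"
    using embedding by (simp add: topological_group_embedding_def embedding_map_def)
  then have "openin (subtopology euclidean (range \<phi>)) (\<phi> ` U)"
    using assms(1) homeomorphic_map_openness[OF h, of U] by (simp add: open_openin[symmetric])
  then obtain W where W: "open W" "\<phi> ` U = W \<inter> range \<phi>"
    by (auto simp: openin_subtopology)
  have "inj \<phi>" using h homeomorphic_imp_injective_map[OF h] by simp
  have "\<phi> -` W \<subseteq> U"
  proof
    fix x assume "x \<in> \<phi> -` W"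
    then have "\<phi> x \<in> \<phi> ` U" using W(2) by simp
    then show "x \<in> U" using \<open>inj \<phi>\<close> by (simp add: inj_image_mem_iff)
  qed
  moreover have "0 \<in> W" using W(2) assms(2) hom_zero by (metis IntD1 imageI)
  ultimately show ?thesis using that W(1) by blast
qed

lemma compact_tube:
  fixes O' :: "('k \<times> 'k \<times> 'k) set"
  assumes "open O'" "\<And>a b. (a, 0, b) \<in> O'"
  obtains V where "open V" "0 \<in> V" "\<And>a b v. v \<in> V \<Longrightarrow> (a, v, b) \<in> O'"
proof -
  define P where "P = (\<lambda>(v, a, b). (a, v, b)) -` O'"
  have "open P"
    unfolding P_def case_prod_unfold by (intro open_vimage assms(1) continuous_intros)
  moreover have "compact (UNIV :: ('k \<times> 'k) set)"
    using compact_Times[OF compact compact] by simp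
  moreover have "{0} \<times> UNIV \<subseteq> P" using assms(2) by (auto simp: P_def)
  ultimately obtain V where "0 \<in> V" "open V" "V \<times> UNIV \<subseteq> P"
    using Elementary_Topology.tube_lemma[of UNIV P 0] by blast
  then have "(v, a, b) \<in> P" if "v \<in> V" for a b v using that by blast
  then show ?thesis using \<open>0 \<in> V\<close> \<open>open V\<close> by (intro that[of V]) (auto simp: P_def)
qed

lemma biuc_comp_hom:
  fixes f :: "'k \<Rightarrow> 'b::real_normed_vector"
  assumes "continuous_on UNIV f"
  shows "biuc (\<lambda>x. f (\<phi> x))"
  unfolding biuc_def
proof (intro allI impI)
  fix e :: real assume e: "e > 0"
  have [continuous_intros]: "continuous_on UNIV (\<lambda>p. f (g p))" if "continuous_on UNIV g"
    for g :: "'k \<times> 'k \<times> 'k \<Rightarrow> 'k"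
    using continuous_on_compose2[OF assms that] by simp
  have "open {(a, v, b). norm (f (a + v + b) - f (a + b)) < e}"
    unfolding case_prod_unfold by (intro open_Collect_less continuous_intros)
  then obtain V where "open V" "0 \<in> V" "\<forall>v\<in>V. \<forall>a b. norm (f (a + v + b) - f (a + b)) < e"
    by (rule compact_tube) (use e in auto)
  then show "\<exists>V. open V \<and> 0 \<in> V \<and> (\<forall>a b. \<forall>v\<in>V. norm (f (\<phi> (a + v + b)) - f (\<phi> (a + b))) \<le> e)"
    using hom_zero
    by (intro exI[of _ "\<phi> -` V"]) (auto simp: hom_add less_imp_le intro: open_vimage cont_hom)
qed

lemma small_conjugates:
  assumes "open U" "(0::'g) \<in> U"
  obtains V where "open V" "0 \<in> V" "\<And>b v. v \<in> V \<Longrightarrow> - b + v + b \<in> U"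
proof -
  obtain W where W: "open W" "0 \<in> W" "\<phi> -` W \<subseteq> U" using nbhd_extends[OF assms] .
  have "open ((\<lambda>(a :: 'k, v, b). - b + v + b) -` W)"
    unfolding case_prod_unfold by (intro open_vimage W(1) continuous_intros)
  then obtain V where V: "open V" "0 \<in> V" "\<forall>v\<in>V. \<forall>b. - b + v + b \<in> W"
    by (rule compact_tube) (use W in auto)
  show ?thesis
  proof (rule that[of "\<phi> -` V"])
    show "open (\<phi> -` V)" by (intro open_vimage V(1) cont_hom)
    show "- b + v + b \<in> U" if "v \<in> \<phi> -` V" for b v
      using V(3)[rule_format, of "\<phi> v" "\<phi> b"] that W(3) by (auto simp: hom_add hom_minus)
  qed (use V hom_zero in simp)
qed

lemma finite_net:
  assumes "open U" "(0::'g) \<in> U"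
  obtains F where "finite F" "F \<subseteq> S" "\<And>x. x \<in> S \<Longrightarrow> \<exists>a\<in>F. \<exists>u\<in>U. x = a + u"
proof -
  obtain W where W: "open W" "0 \<in> W" "\<phi> -` W \<subseteq> U" using nbhd_extends[OF assms] .
  define P where "P = (\<lambda>(x, y). - x + y) -` W"
  have 1: "open P"
    unfolding P_def case_prod_unfold by (intro open_vimage W(1) continuous_intros)
  have "\<exists>A. open A \<and> k \<in> A \<and> (\<forall>x\<in>A. \<forall>y\<in>A. - x + y \<in> W)" for k :: 'k
  proof -
    have "(k, k) \<in> P" using W(2) by (simp add: P_def)
    then obtain A B where AB: "open A" "open B" "(k, k) \<in> A \<times> B" "A \<times> B \<subseteq> P"
      by (rule open_prod_elim[OF 1])
    then have "(x, y) \<in> P" if "x \<in> A" "y \<in> B" for x y using that by blast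
    then show ?thesis using AB by (intro exI[of _ "A \<inter> B"]) (auto simp: P_def)
  qed
  then obtain A where A: "\<And>k. open (A k)" "\<And>k. k \<in> A k"
    "\<And>k x y. x \<in> A k \<Longrightarrow> y \<in> A k \<Longrightarrow> - x + y \<in> W" by metis
  obtain D where D: "finite D" "UNIV \<subseteq> (\<Union>k\<in>D. A k)"
    using compactE_image[OF compact, of UNIV A] A by (metis UNIV_I UN_I subsetI)
  define D' where "D' = {k\<in>D. \<exists>x\<in>S. \<phi> x \<in> A k}"
  have "\<forall>k\<in>D'. \<exists>x\<in>S. \<phi> x \<in> A k" by (simp add: D'_def)
  then obtain g where g: "\<And>k. k \<in> D' \<Longrightarrow> g k \<in> S" "\<And>k. k \<in> D' \<Longrightarrow> \<phi> (g k) \<in> A k" by metis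
  show ?thesis
  proof (rule that[of "g ` D'"])
    show "finite (g ` D')" using D(1) by (simp add: D'_def)
    show "g ` D' \<subseteq> S" using g by auto
    fix x assume "x \<in> S"
    obtain k where "k \<in> D" "\<phi> x \<in> A k" using D(2) by blast
    with \<open>x \<in> S\<close> have k: "k \<in> D'" "\<phi> x \<in> A k" by (auto simp: D'_def)
    then have "- g k + x \<in> U" using A(3)[OF g(2)[OF k(1)] k(2)] W(3) by (auto simp: hom_add hom_minus)
    then show "\<exists>a\<in>g ` D'. \<exists>u\<in>U. x = a + u"
      using k(1) by (intro bexI[of _ "g k"] bexI[of _ "- g k + x"]) (auto simp flip: add.assoc)
  qed
qed

lemma bump_function:
  assumes "open U" "0 \<in> U"
  obtains f :: "'g \<Rightarrow> real" where "biuc f" "f 0 = 1" "\<And>x. 0 \<le> f x" "\<And>x. f x \<le> 1"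
    "\<And>x. x \<notin> U \<Longrightarrow> f x = 0"
proof -
  obtain W where W: "open W" "0 \<in> W" "\<phi> -` W \<subseteq> U" using nbhd_extends[OF assms] .
  have "normal_space (euclidean :: 'k topology)"
    using compact by (intro compact_Hausdorff_or_regular_imp_normal_space disjI1)
      (auto simp: compact_space_def Hausdorff_space_def disjnt_def separation_t2)
  moreover have "closedin euclidean (- W)" "closedin euclidean {0 :: 'k}" "disjnt (- W) {0}"
    using W by (auto simp: closed_closedin[symmetric] disjnt_def)
  ultimately obtain f where f: "continuous_map (euclidean :: 'k topology) (top_of_set {0..1::real}) f"
     "f ` (- W) \<subseteq> {0}" "f ` {0} \<subseteq> {1}"
    using Urysohn_lemma[of euclidean "- W" "{0 :: 'k}" 0 1] by (metis zero_le_one)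
  have "continuous_on UNIV f" "\<And>x. f x \<in> {0..1}"
    using f(1) by (auto simp: continuous_map_in_subtopology)
  moreover have "f (\<phi> x) = 0" if "x \<notin> U" for x
    using that f(2) W(3) by blast
  ultimately show ?thesis
    using f(3) by (intro that[of "\<lambda>x. f (\<phi> x)"] biuc_comp_hom) (auto simp: hom_zero)
qed

lemma biuc_bounded:
  fixes f :: "'g \<Rightarrow> 'b::real_normed_vector"
  assumes "biuc f"
  obtains d where "d \<ge> 0" "\<And>x y. norm (f x - f y) \<le> d"
proof -
  obtain V where V: "open V" "0 \<in> V" "\<forall>v\<in>V. \<forall>x. norm (f (x + v) - f x) \<le> 1"
    using biuc_continuous[OF assms zero_less_one] .
  obtain F where F: "finite F" "\<And>x. \<exists>a\<in>F. \<exists>u\<in>V. x = a + u"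
    using finite_net[OF V(1,2), of UNIV] by (metis UNIV_I)
  define B where "B = (\<Sum>a\<in>F. norm (f a)) + 1"
  have "norm (f x) \<le> B" for x
  proof -
    obtain a u where "a \<in> F" "u \<in> V" "x = a + u" using F(2) by blast
    then have "norm (f x - f a) \<le> 1" "norm (f a) \<le> (\<Sum>a\<in>F. norm (f a))"
      using V(3)[rule_format] F(1) by (auto intro: member_le_sum)
    then show ?thesis using norm_triangle_ineq[of "f x - f a" "f a"] by (simp add: B_def)
  qed
  then have "norm (f x - f y) \<le> B + B" for x y
    by (meson norm_triangle_ineq4 add_mono order_trans)
  moreover have "B + B \<ge> 0" by (simp add: B_def sum_nonneg)
  ultimately show ?thesis using that by blast
qed

text \<open>
  For all \<open>x\<close>, \<open>y\<close> one of the points \<open>x + a\<close> is close to one of the points \<open>y + a\<close>; pairing off the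
  other points arbitrarily, averaging over a net contracts the oscillation.
\<close>

lemma avg_oscillation:
  fixes f :: "'g \<Rightarrow> 'b::real_normed_vector"
  assumes osc: "\<And>x v. v \<in> V \<Longrightarrow> norm (f (x + v) - f x) \<le> e"
    and net: "\<And>z. \<exists>a\<in>set xs. \<exists>v\<in>V. z = a + v"
    and d: "\<And>x y. norm (f x - f y) \<le> d"
  shows "norm (avg xs f x - avg xs f y) \<le> ((real (length xs) - 1) * d + e) / real (length xs)"
proof -
  have ne: "xs \<noteq> []" using net by force
  define b where "b = hd xs"
  have b: "b \<in> set xs" using ne by (simp add: b_def)
  obtain a v where av: "a \<in> set xs" "v \<in> V" "- x + y + b = a + v" using net by blast
  have yb: "y + b = x + a + v" using arg_cong[OF av(3), of "(+) x"] by (simp add: add.assoc)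
  have rest: "norm ((\<Sum>c\<leftarrow>us. f (x + c)) - (\<Sum>c\<leftarrow>vs. f (y + c))) \<le> real (length us) * d"
    if "length us = length vs" for us vs
    using that
  proof (induction us vs rule: list_induct2)
    case (Cons p ps q qs)
    have "norm ((\<Sum>c\<leftarrow>p # ps. f (x + c)) - (\<Sum>c\<leftarrow>q # qs. f (y + c))) =
        norm ((f (x + p) - f (y + q)) + ((\<Sum>c\<leftarrow>ps. f (x + c)) - (\<Sum>c\<leftarrow>qs. f (y + c))))"
      by (simp add: algebra_simps)
    also have "\<dots> \<le> d + real (length ps) * d"
      using norm_triangle_mono[OF d Cons.IH] .
    finally show ?case by (simp add: algebra_simps)
  qed simp
  have len: "length (remove1 a xs) = length (remove1 b xs)" "real (length (remove1 a xs)) = real (length xs) - 1"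
    using av(1) b by (auto simp: length_remove1 of_nat_diff Suc_le_eq ne)
  have "(\<Sum>c\<leftarrow>xs. f (x + c)) - (\<Sum>c\<leftarrow>xs. f (y + c)) = - (f (x + a + v) - f (x + a)) +
      ((\<Sum>c\<leftarrow>remove1 a xs. f (x + c)) - (\<Sum>c\<leftarrow>remove1 b xs. f (y + c)))"
    using sum_list_map_remove1[OF av(1), of "\<lambda>c. f (x + c)"] sum_list_map_remove1[OF b, of "\<lambda>c. f (y + c)"]
    by (simp add: yb)
  also have "norm \<dots> \<le> e + (real (length xs) - 1) * d"
    using norm_triangle_mono[OF _ rest[OF len(1)]] osc[OF av(2)] by (simp add: len(2) norm_minus_commute)
  finally have 1: "norm ((\<Sum>c\<leftarrow>xs. f (x + c)) - (\<Sum>c\<leftarrow>xs. f (y + c))) \<le> (real (length xs) - 1) * d + e"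
    by simp
  have "avg xs f x - avg xs f y = ((\<Sum>c\<leftarrow>xs. f (x + c)) - (\<Sum>c\<leftarrow>xs. f (y + c))) /\<^sub>R real (length xs)"
    by (simp add: avg_def scaleR_diff_right)
  then have "norm (avg xs f x - avg xs f y) = norm ((\<Sum>c\<leftarrow>xs. f (x + c)) - (\<Sum>c\<leftarrow>xs. f (y + c))) / real (length xs)"
    by (simp add: divide_inverse_commute)
  then show ?thesis using 1 by (simp add: divide_right_mono)
qed

lemma avg_almost_constant:
  fixes f :: "'g \<Rightarrow> 'b::real_normed_vector"
  assumes f: "biuc f" and e: "e > 0"
  obtains xs where "xs \<noteq> []" "\<forall>x y. norm (avg xs f x - avg xs f y) \<le> e"
proof -
  obtain d where d: "d \<ge> 0" "\<forall>x y. norm (f x - f y) \<le> d" using biuc_bounded[OF f] by metis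
  have e2: "e / 2 > 0" using e by simp
  obtain V where V: "open V" "0 \<in> V" "\<forall>v\<in>V. \<forall>a b. norm (f (a + v + b) - f (a + b)) \<le> e / 2"
    using biucD[OF f e2] .
  obtain F where F: "finite F" "\<forall>x. \<exists>a\<in>F. \<exists>u\<in>V. x = a + u"
    using finite_net[OF V(1,2), of UNIV] by (metis UNIV_I)
  obtain xs where xs: "set xs = F" using finite_list[OF F(1)] by blast
  have net: "\<exists>a\<in>set xs. \<exists>v\<in>V. z = a + v" for z using F(2) xs by simp
  have ne: "xs \<noteq> []" using net by force
  define N where "N = real (length xs)"
  have N: "N \<ge> 1" using ne by (cases xs) (auto simp: N_def)
  define r where "r = (N - 1) / N"
  have r: "0 \<le> r" "r < 1" using N by (auto simp: r_def)
  have "\<exists>ys. ys \<noteq> [] \<and> (\<forall>x y. norm (avg ys f x - avg ys f y) \<le> r ^ k * d + e / 2)" for k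
  proof (induction k)
    case 0
    have "avg [0] f = f" by (auto simp: avg_def)
    then show ?case using d(2) e2 by (intro exI[of _ "[0]"]) (auto intro: add_increasing2)
  next
    case (Suc k)
    then obtain ys where ys: "ys \<noteq> []" "\<And>x y. norm (avg ys f x - avg ys f y) \<le> r ^ k * d + e / 2" by blast
    have "norm (avg ys f (x + v) - avg ys f x) \<le> e / 2" if "v \<in> V" for x v
    proof -
      have "avg ys f (x + v) - avg ys f x = avg ys (\<lambda>z. f (x + v + z) - f (x + z)) 0"
        by (simp add: avg_def sum_list_subtractf scaleR_diff_right)
      moreover have "norm (f (x + v + z) - f (x + z)) \<le> e / 2" for z using V(3) that by blast
      ultimately show ?thesis using norm_avg_le[OF ys(1), of "\<lambda>z. f (x + v + z) - f (x + z)" "e / 2" 0] by simp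
    qed
    from avg_oscillation[OF this net ys(2)]
    have "norm (avg xs (avg ys f) x - avg xs (avg ys f) y) \<le> ((N - 1) * (r ^ k * d + e / 2) + e / 2) / N" for x y
      by (simp add: N_def)
    moreover have "((N - 1) * (r ^ k * d + e / 2) + e / 2) / N = r ^ Suc k * d + e / 2"
      using N by (simp add: r_def field_simps)
    ultimately show ?case
      using ys(1) ne unfolding avg_avg by (intro exI[of _ "addlists xs ys"]) (auto simp: addlists_Nil_iff)
  qed
  then obtain ys where ys: "\<And>k. ys k \<noteq> []" "\<And>k x y. norm (avg (ys k) f x - avg (ys k) f y) \<le> r ^ k * d + e / 2"
    by metis
  have "(\<lambda>k. r ^ k * d) \<longlonglongrightarrow> 0 * d" using r by (intro tendsto_intros LIMSEQ_power_zero) auto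
  then have "eventually (\<lambda>k. r ^ k * d < e / 2) sequentially"
    using e2 by (intro order_tendstoD(2)[of _ 0]) simp_all
  then obtain k where k: "r ^ k * d < e / 2" by (auto simp: eventually_sequentially)
  have "norm (avg (ys k) f x - avg (ys k) f y) \<le> e" for x y
    using ys(2)[of k x y] k by simp
  with ys(1) show ?thesis using that by blast
qed

lemma avgl_almost_constant:
  fixes f :: "'g \<Rightarrow> 'b::real_normed_vector"
  assumes f: "biuc f" and e: "e > 0"
  obtains xs where "xs \<noteq> []" "\<forall>x y. norm (avgl xs f x - avgl xs f y) \<le> e"
proof -
  obtain xs where xs: "xs \<noteq> []" "\<forall>x y. norm (avg xs (\<lambda>x. f (- x)) x - avg xs (\<lambda>x. f (- x)) y) \<le> e"
    using avg_almost_constant[OF biuc_uminus[OF f] e] .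
  have "avgl (map uminus xs) f x = avg xs (\<lambda>x. f (- x)) (- x)" for x
    by (simp add: avg_def avgl_def comp_def minus_add)
  then show ?thesis using xs by (intro that[of "map uminus xs"]) auto
qed

lemma means_close:
  fixes f :: "'g \<Rightarrow> 'b::real_normed_vector"
  assumes f: "biuc f" and xs: "xs \<noteq> []" "\<forall>x. norm (avg xs f x - c) \<le> e"
    and ys: "ys \<noteq> []" "\<forall>x. norm (avg ys f x - d) \<le> e'"
  shows "norm (c - d) \<le> e + e'"
proof (rule field_le_epsilon)
  fix r :: real assume "r > 0"
  then have r: "r / 2 > 0" by simp
  obtain zs where zs: "zs \<noteq> []" "\<forall>x y. norm (avgl zs f x - avgl zs f y) \<le> r / 2"
    using avgl_almost_constant[OF f r] .
  define m where "m = avgl zs f 0"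
  have *: "norm (c' - m) \<le> e'' + r / 2" if ws: "ws \<noteq> []" "\<forall>x. norm (avg ws f x - c') \<le> e''" for ws c' e''
  proof -
    have "avgl zs (\<lambda>x. avg ws f x - c') 0 = avgl zs (avg ws f) 0 - c'"
      using avgl_in_convex[of "{c'}" zs "\<lambda>_. c'" 0] zs(1) by (simp add: avgl_diff)
    then have 1: "norm (avgl zs (avg ws f) 0 - c') \<le> e''"
      using norm_avgl_le[OF zs(1), of "\<lambda>x. avg ws f x - c'" e'' 0] ws(2) by simp
    have "avg ws (\<lambda>x. avgl zs f x - m) 0 = avg ws (avgl zs f) 0 - m"
      using ws(1) by (simp add: avg_diff avg_const)
    then have "norm (avg ws (avgl zs f) 0 - m) \<le> r / 2"
      using norm_avg_le[OF ws(1), of "\<lambda>x. avgl zs f x - m" "r / 2" 0] zs(2) by (simp add: m_def)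
    then show ?thesis
      using 1 norm_triangle_mono[of "c' - avgl zs (avg ws f) 0" e'' "avgl zs (avg ws f) 0 - m" "r / 2"]
      by (simp add: avgl_avg norm_minus_commute)
  qed
  show "norm (c - d) \<le> e + e' + r"
    using norm_triangle_mono[OF *[OF xs] *[OF ys, THEN eq_refl[OF norm_minus_commute, THEN order_trans]]] by simp
qed

lemma has_mean_unique:
  fixes f :: "'g \<Rightarrow> 'b::real_normed_vector"
  assumes "biuc f" "has_mean f c" "has_mean f d"
  shows "c = d"
proof -
  have "norm (c - d) \<le> 0 + e" if "e > 0" for e
  proof -
    have "e / 2 > 0" using that by simp
    then obtain xs ys where "xs \<noteq> []" "\<forall>x. norm (avg xs f x - c) \<le> e / 2" "ys \<noteq> []" "\<forall>x. norm (avg ys f x - d) \<le> e / 2"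
      using assms(2,3) unfolding has_mean_def by metis
    from means_close[OF assms(1) this] show ?thesis by simp
  qed
  then have "norm (c - d) \<le> 0" by (rule field_le_epsilon)
  then show ?thesis by simp
qed

lemma has_mean_exists:
  fixes f :: "'g \<Rightarrow> 'b::banach"
  assumes f: "biuc f"
  obtains c where "has_mean f c"
proof -
  have "\<exists>xs. xs \<noteq> [] \<and> (\<forall>x. norm (avg xs f x - avg xs f 0) \<le> inverse (real (Suc n)))" for n
    using avg_almost_constant[OF f, of "inverse (real (Suc n))"] by (metis inverse_positive_iff_positive of_nat_0_less_iff zero_less_Suc)
  then obtain xs where xs: "\<And>n. xs n \<noteq> []"
    "\<And>n. \<forall>x. norm (avg (xs n) f x - avg (xs n) f 0) \<le> inverse (real (Suc n))" by metis
  define c where "c n = avg (xs n) f 0" for n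
  have close: "norm (c n - c m) \<le> inverse (real (Suc n)) + inverse (real (Suc m))" for n m
    unfolding c_def using means_close[OF f xs xs] .
  have "Cauchy c"
  proof (rule CauchyI)
    fix e :: real assume "e > 0"
    then obtain M where M: "inverse (real (Suc M)) < e / 2" using reals_Archimedean half_gt_zero by blast
    have "norm (c m - c n) < e" if "m \<ge> M" "n \<ge> M" for m n
    proof -
      have "inverse (real (Suc m)) \<le> inverse (real (Suc M))" "inverse (real (Suc n)) \<le> inverse (real (Suc M))"
        using that by (auto intro!: le_imp_inverse_le)
      then show ?thesis using close[of m n] M by linarith
    qed
    then show "\<exists>M. \<forall>m\<ge>M. \<forall>n\<ge>M. norm (c m - c n) < e" by blast
  qed
  then obtain l where l: "c \<longlonglongrightarrow> l" using Cauchy_convergent_iff convergent_def by blast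
  have "has_mean f l"
    unfolding has_mean_def
  proof (intro allI impI)
    fix e :: real assume e: "e > 0"
    obtain M where M: "inverse (real (Suc M)) < e / 2" using reals_Archimedean half_gt_zero[OF e] by blast
    obtain K where K: "\<forall>n\<ge>K. norm (c n - l) < e / 2"
      using LIMSEQ_D[OF l half_gt_zero[OF e]] by blast
    define n where "n = max M K"
    have "norm (avg (xs n) f x - l) \<le> e" for x
    proof -
      have "inverse (real (Suc n)) \<le> inverse (real (Suc M))"
        unfolding n_def by (intro le_imp_inverse_le) auto
      then have "norm (avg (xs n) f x - c n) \<le> e / 2"
        using xs(2)[of n] M unfolding c_def by (meson less_imp_le order_trans)
      moreover have "norm (c n - l) \<le> e / 2" using K by (simp add: n_def less_imp_le)
      ultimately have "norm ((avg (xs n) f x - c n) + (c n - l)) \<le> e / 2 + e / 2"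
        by (rule norm_triangle_mono)
      then show ?thesis by simp
    qed
    then show "\<exists>xs. xs \<noteq> [] \<and> (\<forall>x. norm (avg xs f x - l) \<le> e)" using xs(1) by blast
  qed
  then show ?thesis by (rule that)
qed

lemma has_mean_add:
  fixes f g :: "'g \<Rightarrow> 'b::banach"
  assumes f: "biuc f" "has_mean f c" and g: "biuc g" "has_mean g d"
  shows "has_mean (\<lambda>x. f x + g x) (c + d)"
  unfolding has_mean_def
proof (intro allI impI)
  fix e :: real assume "e > 0"
  then have e: "e / 2 > 0" by simp
  then obtain xs where xs: "xs \<noteq> []" "\<forall>x. norm (avg xs f x - c) \<le> e / 2"
    using f(2) unfolding has_mean_def by blast
  obtain d' where d': "has_mean (avg xs g) d'" using has_mean_exists[OF biuc_avg[OF g(1) xs(1)]] .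
  have "d' = d" using has_mean_unique[OF g(1) has_mean_of_avg[OF d' xs(1)] g(2)] .
  then obtain ys where ys: "ys \<noteq> []" "\<forall>x. norm (avg ys (avg xs g) x - d) \<le> e / 2"
    using d' e unfolding has_mean_def by blast
  have "norm (avg (addlists ys xs) (\<lambda>x. f x + g x) x - (c + d)) \<le> e" for x
  proof -
    have "norm (avg ys (\<lambda>x. avg xs f x - c) x) \<le> e / 2"
      by (rule norm_avg_le[OF ys(1)]) (use xs(2) in blast)
    then have "norm (avg ys (avg xs f) x - c) \<le> e / 2"
      using ys(1) by (simp add: avg_diff avg_const)
    from norm_triangle_mono[OF this ys(2)[rule_format, of x]]
    show ?thesis by (simp add: avg_add avg_avg algebra_simps)
  qed
  then show "\<exists>xs. xs \<noteq> [] \<and> (\<forall>x. norm (avg xs (\<lambda>x. f x + g x) x - (c + d)) \<le> e)"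
    using xs(1) ys(1) by (intro exI[of _ "addlists ys xs"]) (auto simp: addlists_Nil_iff)
qed

lemma has_mean_sum:
  fixes f :: "'i \<Rightarrow> 'g \<Rightarrow> 'b::banach"
  assumes "\<And>i. i \<in> I \<Longrightarrow> biuc (f i)" "\<And>i. i \<in> I \<Longrightarrow> has_mean (f i) (c i)"
  shows "has_mean (\<lambda>x. \<Sum>i\<in>I. f i x) (\<Sum>i\<in>I. c i)"
  using assms
proof (induction I rule: infinite_finite_induct)
  case (insert i I)
  then have "has_mean (\<lambda>x. f i x + (\<Sum>i\<in>I. f i x)) (c i + (\<Sum>i\<in>I. c i))"
    by (intro has_mean_add biuc_sum) auto
  then show ?case using insert by simp
qed (auto simp: has_mean_def avg_const intro!: exI[of _ "[0]"])

lemma has_mean_diff: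
  fixes f g :: "'g \<Rightarrow> 'b::banach"
  assumes f: "biuc f" "has_mean f c" and g: "biuc g" "has_mean g d"
  shows "has_mean (\<lambda>x. f x - g x) (c - d)"
proof -
  have neg: "bounded_linear (uminus :: 'b \<Rightarrow> 'b)"
    using bounded_linear_minus[OF bounded_linear_ident] by simp
  show ?thesis
    using has_mean_add[OF f biuc_bounded_linear[OF neg g(1)] has_mean_bounded_linear[OF neg g(2)]] by simp
qed

lemma has_mean_mono:
  fixes f g :: "'g \<Rightarrow> real"
  assumes "biuc f" "has_mean f c" "biuc g" "has_mean g d" "\<And>x. f x \<le> g x"
  shows "c \<le> d"
  using has_mean_ge[OF has_mean_diff[OF assms(3,4,1,2)], of 0] assms(5) by simp

lemma has_mean_diff_le:
  fixes f g :: "'g \<Rightarrow> 'b::banach"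
  assumes "biuc f" "has_mean f c" "biuc g" "has_mean g d" "\<And>x. norm (f x - g x) \<le> e"
  shows "norm (c - d) \<le> e"
  using has_mean_norm_le[OF has_mean_diff[OF assms(1-4)] assms(5)] .

lemma mean_ge_on_nbhd:
  assumes V: "open V" "(0::'g) \<in> V"
  obtains k :: real where "k > 0"
    "\<And>f a c. has_mean f c \<Longrightarrow> (\<And>x. 0 \<le> f x) \<Longrightarrow> (\<And>x. x \<in> V \<Longrightarrow> a \<le> f x) \<Longrightarrow> a \<ge> 0 \<Longrightarrow> k * a \<le> c"
proof -
  obtain F where F: "finite F" "\<forall>x. \<exists>a\<in>F. \<exists>u\<in>V. x = a + u"
    using finite_net[OF V, of UNIV] by (metis UNIV_I)
  obtain xs where xs: "set xs = F" using finite_list[OF F(1)] by blast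
  define ys where "ys = map uminus xs"
  have ne: "ys \<noteq> []" using F(2) xs by (auto simp: ys_def)
  show ?thesis
  proof (rule that[of "1 / real (length ys)"])
    fix f :: "'g \<Rightarrow> real" and a c
    assume f: "has_mean f c" "\<And>x. 0 \<le> f x" "\<And>x. x \<in> V \<Longrightarrow> a \<le> f x"
    have "1 / real (length ys) * a \<le> avgl ys f x" for x
    proof -
      obtain b u where b: "b \<in> F" "u \<in> V" "x = b + u" using F(2) by blast
      then have "f u \<in> set (map (\<lambda>b. f (b + x)) ys)"
        using xs by (auto simp: ys_def simp flip: add.assoc intro!: image_eqI[of _ _ b])
      then have "f u \<le> (\<Sum>b\<leftarrow>ys. f (b + x))"
        using f(2) by (intro member_le_sum_list) auto
      then have "a \<le> (\<Sum>b\<leftarrow>ys. f (b + x))" using f(3)[OF b(2)] by simp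
      then show ?thesis by (simp add: avgl_def divide_inverse mult_left_mono)
    qed
    then show "1 / real (length ys) * a \<le> c"
      by (rule has_mean_ge[OF has_mean_avgl[OF f(1) ne]])
  qed (use ne in simp)
qed

end

subsection \<open>Complex Hilbert spaces and rank one operators\<close>

instance complex_hilbert_space \<subseteq> banach ..

lemma cinner_add_right: "cinner x (y + z) = cinner x y + cinner (x::'h::complex_hilbert_space) z"
  by (metis cinner_commute cinner_add_left complex_cnj_add)

lemma cinner_scaleC_right: "cinner x (c *\<^sub>C y) = cnj c * cinner (x::'h::complex_hilbert_space) y"
  by (metis cinner_commute cinner_scaleC_left complex_cnj_mult)

lemma cinner_scaleR_left: "cinner (r *\<^sub>R x) y = r *\<^sub>R cinner (x::'h::complex_hilbert_space) y"
  by (simp add: cinner_scaleC_left scaleR_conv_of_real flip: scaleC_of_real)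

lemma cinner_scaleR_right: "cinner x (r *\<^sub>R y) = r *\<^sub>R cinner (x::'h::complex_hilbert_space) y"
  by (simp add: cinner_scaleC_right scaleR_conv_of_real flip: scaleC_of_real)

lemma cinner_self: "cinner x x = complex_of_real ((norm (x::'h::complex_hilbert_space))\<^sup>2)"
proof -
  have "Im (cinner x x) = 0" using cinner_commute[of x x] by (simp add: complex_eq_iff)
  then show ?thesis
    by (simp add: complex_eq_iff power2_norm_eq_inner inner_eq_Re_cinner)
qed

lemma norm_scaleC: "norm (c *\<^sub>C x) = cmod c * norm (x::'h::complex_hilbert_space)"
proof -
  have "complex_of_real ((cmod c)\<^sup>2) = c * cnj c" by (rule complex_norm_square)
  then have "complex_of_real ((norm (c *\<^sub>C x))\<^sup>2) = complex_of_real ((cmod c)\<^sup>2) * cinner x x"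
    by (simp only: cinner_self[symmetric]) (simp add: cinner_scaleC_left cinner_scaleC_right)
  also have "\<dots> = complex_of_real ((cmod c * norm x)\<^sup>2)"
    by (simp add: cinner_self power_mult_distrib)
  finally have "complex_of_real ((norm (c *\<^sub>C x))\<^sup>2) = complex_of_real ((cmod c * norm x)\<^sup>2)" .
  then have "(norm (c *\<^sub>C x))\<^sup>2 = (cmod c * norm x)\<^sup>2" by (simp only: of_real_eq_iff)
  then show ?thesis by (simp add: power2_eq_iff_nonneg)
qed

lemma cmod_cinner_le: "cmod (cinner x y) \<le> norm x * norm (y::'h::complex_hilbert_space)"
proof (cases "cinner x y = 0")
  case False
  define c where "c = cnj (cinner x y) / cmod (cinner x y)"
  have "cmod c = 1" using False by (simp add: c_def norm_divide)
  have "cinner (c *\<^sub>C x) y = complex_of_real (cmod (cinner x y))"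
    using False unfolding c_def
    by (simp add: cinner_scaleC_left complex_norm_square[symmetric] mult.commute power2_eq_square)
  then have "cmod (cinner x y) = inner (c *\<^sub>C x) y" by (simp add: inner_eq_Re_cinner)
  also have "\<dots> \<le> norm (c *\<^sub>C x) * norm y" by (rule norm_cauchy_schwarz)
  finally show ?thesis by (simp add: norm_scaleC \<open>cmod c = 1\<close>)
qed simp

lemma bounded_bilinear_cinner: "bounded_bilinear (cinner :: 'h::complex_hilbert_space \<Rightarrow> 'h \<Rightarrow> complex)"
  by (rule bounded_bilinear.intro)
    (auto simp: cinner_add_left cinner_add_right cinner_scaleR_left cinner_scaleR_right
      intro!: exI[of _ 1] cmod_cinner_le)

lemma bounded_bilinear_scaleC: "bounded_bilinear (scaleC :: complex \<Rightarrow> 'h::complex_hilbert_space \<Rightarrow> 'h)"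
proof (rule bounded_bilinear.intro)
  show "(r *\<^sub>R a) *\<^sub>C b = r *\<^sub>R a *\<^sub>C b" for r a and b :: 'h
    by (simp add: scaleR_conv_of_real scaleC_scaleC flip: scaleC_of_real)
  show "a *\<^sub>C r *\<^sub>R b = r *\<^sub>R a *\<^sub>C b" for r a and b :: 'h
    by (simp add: scaleC_scaleC mult.commute flip: scaleC_of_real)
qed (auto simp: scaleC_add_left scaleC_add_right norm_scaleC intro!: exI[of _ 1])

interpretation cinner: bounded_bilinear "cinner :: 'h::complex_hilbert_space \<Rightarrow> 'h \<Rightarrow> complex"
  by (rule bounded_bilinear_cinner)

interpretation scaleC: bounded_bilinear "scaleC :: complex \<Rightarrow> 'h::complex_hilbert_space \<Rightarrow> 'h"
  by (rule bounded_bilinear_scaleC)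

lemma cinner_eqI:
  assumes "\<And>t. cinner x t = cinner (y::'h::complex_hilbert_space) t"
  shows "x = y"
proof -
  have "cinner (x - y) (x - y) = 0" using assms[of "x - y"] by (simp add: cinner.diff_left)
  then show ?thesis by (simp add: cinner_self)
qed

lemma closed_csubspace_subspace: "closed_csubspace E \<Longrightarrow> subspace E"
  unfolding closed_csubspace_def subspace_def by (metis scaleC_of_real)

lemma bounded_linear_rank_one:
  "bounded_linear (\<lambda>u. cinner u a *\<^sub>C (b :: 'h::complex_hilbert_space))"
  by (intro bounded_linear_compose[OF scaleC.bounded_linear_left cinner.bounded_linear_left])

definition rank_one :: "'h \<Rightarrow> 'h \<Rightarrow> 'h \<Rightarrow>\<^sub>L ('h::complex_hilbert_space)" where
  "rank_one a b = Blinfun (\<lambda>u. cinner u a *\<^sub>C b)"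

lemma rank_one_apply: "rank_one a b u = cinner u a *\<^sub>C b"
  unfolding rank_one_def by (simp add: bounded_linear_Blinfun_apply bounded_linear_rank_one)

lemma norm_rank_one_diff:
  "norm (rank_one a b - rank_one a' b') \<le> norm b * norm (a - a') + norm a' * norm (b - b')"
proof (rule norm_blinfun_bound)
  fix u
  have "(rank_one a b - rank_one a' b') u = cinner u (a - a') *\<^sub>C b + cinner u a' *\<^sub>C (b - b')"
    by (simp add: blinfun.diff_left rank_one_apply cinner.diff_right scaleC.diff_left scaleC.diff_right)
  also have "norm \<dots> \<le> (norm u * norm (a - a')) * norm b + (norm u * norm a') * norm (b - b')"
    by (intro norm_triangle_mono) (auto simp: norm_scaleC intro!: mult_right_mono cmod_cinner_le)
  finally show "norm ((rank_one a b - rank_one a' b') u)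
      \<le> (norm b * norm (a - a') + norm a' * norm (b - b')) * norm u" by (simp add: algebra_simps)
qed simp

lemma rank_one_image_compact:
  "compact ((\<lambda>c. c *\<^sub>C (b :: 'h::complex_hilbert_space)) ` cball 0 r)"
  by (intro compact_continuous_image compact_cball continuous_on_subset[OF scaleC.continuous_on]
      continuous_intros linear_continuous_on scaleC.bounded_linear_left)

lemma rank_one_sum_bounded_image:
  fixes a b :: "'g \<Rightarrow> 'h::complex_hilbert_space"
  shows "\<exists>Z. compact Z \<and> (\<forall>u. norm u \<le> 1 \<longrightarrow> (\<Sum>x\<leftarrow>xs. rank_one (a x) (b x)) u \<in> Z)"
proof (induction xs)
  case (Cons x xs)
  then obtain Z where Z: "compact Z" "\<forall>u. norm u \<le> 1 \<longrightarrow> (\<Sum>x\<leftarrow>xs. rank_one (a x) (b x)) u \<in> Z" by blast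
  define Y where "Y = (\<lambda>c. c *\<^sub>C b x) ` cball 0 (norm (a x))"
  have "rank_one (a x) (b x) u \<in> Y" if "norm u \<le> 1" for u
  proof -
    have "cmod (cinner u (a x)) \<le> norm u * norm (a x)" by (rule cmod_cinner_le)
    also have "\<dots> \<le> 1 * norm (a x)" using that by (intro mult_right_mono) auto
    finally show ?thesis unfolding Y_def rank_one_apply by (intro imageI) simp
  qed
  then have "(\<Sum>x\<leftarrow>x # xs. rank_one (a x) (b x)) u \<in> {y + z |y z. y \<in> Y \<and> z \<in> Z}" if "norm u \<le> 1" for u
    using Z(2) that by (auto simp: blinfun.add_left)
  then show ?case
    using compact_sums[OF rank_one_image_compact[of "b x" "norm (a x)"] Z(1)]
    by (intro exI[of _ "{y + z |y z. y \<in> Y \<and> z \<in> Z}"]) (auto simp: Y_def)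
qed (auto intro: exI[of _ "{0}"])

subsection \<open>Schur's lemma for compact intertwiners\<close>

context
  fixes E :: "'h::complex_hilbert_space set" and \<rho> :: "'g::topological_group_add \<Rightarrow> 'h \<Rightarrow> 'h"
  assumes rep: "unitary_rep (E, \<rho>)"
begin

lemma rep_csubspace: "closed_csubspace E"
  using rep by (simp add: unitary_rep_def)

lemma rep_subspace: "subspace E"
  using rep_csubspace by (rule closed_csubspace_subspace)

lemma rep_closed_space: "closed E"
  using rep_csubspace by (simp add: closed_csubspace_def)

lemma rep_in: "v \<in> E \<Longrightarrow> \<rho> x v \<in> E"
  using rep by (rule unitary_rep_closed)

lemma rep_unitary_map: "unitary_map E E (\<rho> x)"
  using rep unfolding unitary_rep_def unitary_sot_def continuous_map_in_subtopology unitary_group_def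
  by auto

lemma rep_plus: "u \<in> E \<Longrightarrow> v \<in> E \<Longrightarrow> \<rho> x (u + v) = \<rho> x u + \<rho> x v"
  using rep_unitary_map by (simp add: unitary_map_def)

lemma rep_scaleC: "v \<in> E \<Longrightarrow> \<rho> x (c *\<^sub>C v) = c *\<^sub>C \<rho> x v"
  using rep_unitary_map by (simp add: unitary_map_def)

lemma rep_scaleR: "v \<in> E \<Longrightarrow> \<rho> x (r *\<^sub>R v) = r *\<^sub>R \<rho> x v"
  by (simp add: rep_scaleC flip: scaleC_of_real)

lemma rep_cinner: "u \<in> E \<Longrightarrow> v \<in> E \<Longrightarrow> cinner (\<rho> x u) (\<rho> x v) = cinner u v"
  using rep_unitary_map by (simp add: unitary_map_def)

lemma rep_norm: "v \<in> E \<Longrightarrow> norm (\<rho> x v) = norm v"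
  using rep_cinner[of v v x] by (simp add: norm_eq_sqrt_inner inner_eq_Re_cinner)

lemma rep_minus: "u \<in> E \<Longrightarrow> v \<in> E \<Longrightarrow> \<rho> x (u - v) = \<rho> x u - \<rho> x v"
  using rep_plus[of u "- v" x] rep_scaleR[of v x "- 1"] subspace_neg[OF rep_subspace, of v] by simp

lemma rep_add: "v \<in> E \<Longrightarrow> \<rho> (x + y) v = \<rho> x (\<rho> y v)"
  using rep by (simp add: unitary_rep_def compose_def)

lemma rep_zero:
  assumes "v \<in> E"
  shows "\<rho> 0 v = v"
proof -
  have "inj_on (\<rho> 0) E" using rep_unitary_map by (simp add: unitary_map_def bij_betw_def)
  then show ?thesis using rep_add[OF assms, of 0 0] rep_in[OF assms] assms
    by (auto dest: inj_onD)
qed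

lemma rep_continuous:
  assumes "v \<in> E"
  shows "continuous_on UNIV (\<lambda>x. \<rho> x v)"
proof -
  have "continuous_map euclidean (product_topology (\<lambda>_. euclidean) E) \<rho>"
    using rep by (simp add: unitary_rep_def unitary_sot_def continuous_map_in_subtopology)
  then show ?thesis using assms by (simp add: continuous_map_componentwise)
qed

end

lemma irreducible_repD:
  assumes "irreducible_rep (E, \<rho>)"
  shows "unitary_rep (E, \<rho>)" "E \<noteq> {0}"
    "\<And>W. closed_csubspace W \<Longrightarrow> (\<And>g u. u \<in> W \<Longrightarrow> \<rho> g u \<in> W) \<Longrightarrow> W \<noteq> {0} \<Longrightarrow> W \<subseteq> E \<Longrightarrow> W = E"
proof -
  show "unitary_rep (E, \<rho>)" "E \<noteq> {0}" using assms by (simp_all add: irreducible_rep_def)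
  fix W assume W: "closed_csubspace W" "\<And>g u. u \<in> W \<Longrightarrow> \<rho> g u \<in> W" "W \<noteq> {0}" "W \<subseteq> E"
  have "0 \<in> W" using W(1) by (simp add: closed_csubspace_def)
  then show "W = E" using assms W unfolding irreducible_rep_def by blast
qed

text \<open>
  No spectral theorem is needed: compactness makes \<open>sup {norm (S u) | norm u \<le> 1}\<close> attained, at an
  eigenvector of \<open>S' S\<close>, and the eigenspace is invariant.
\<close>

lemma schur_scalar:
  fixes S S' :: "'h::complex_hilbert_space \<Rightarrow>\<^sub>L 'h" and \<rho> :: "'g::topological_group_add \<Rightarrow> 'h \<Rightarrow> 'h"
  assumes irr: "irreducible_rep (E, \<rho>)"
    and adj: "\<And>u u'. cinner (S u) u' = cinner u (S' u')"
    and S'E: "\<And>u. S' u \<in> E"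
    and comm: "\<And>g u. u \<in> E \<Longrightarrow> S' (S (\<rho> g u)) = \<rho> g (S' (S u))"
    and cpt: "compact (closure (S ` cball 0 1))"
  obtains l where "l \<ge> 0" "\<forall>u\<in>E. S' (S u) = l *\<^sub>R u"
proof (cases "\<forall>u\<in>E. S u = 0")
  case True
  then show ?thesis by (intro that[of 0]) (auto simp: blinfun.zero_right)
next
  case False
  note rep = irreducible_repD(1)[OF irr]
  have E: "subspace E" "closed E" using rep_subspace[OF rep] rep_closed_space[OF rep] .
  obtain u0 where u0: "u0 \<in> E" "S u0 \<noteq> 0" using False by blast
  define A where "A = (\<lambda>u. norm (S u)) ` (E \<inter> cball 0 1)"
  define m where "m = Sup A"
  have A: "bdd_above A" "A \<noteq> {}"
  proof -
    show "bdd_above A" unfolding A_def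
      by (rule bdd_aboveI2[of _ _ "norm S"])
        (use norm_blinfun[of S] in \<open>force intro: order_trans mult_left_le\<close>)
    show "A \<noteq> {}" using subspace_0[OF E(1)] by (auto simp: A_def disjoint_iff intro!: exI[of _ 0])
  qed
  have Sm: "norm (S u) \<le> m * norm u" if u: "u \<in> E" for u
  proof (cases "u = 0")
    case False
    have "norm (S (u /\<^sub>R norm u)) \<in> A"
      using u False E(1) by (auto simp: A_def subspace_scale intro!: imageI)
    then have "norm (S (u /\<^sub>R norm u)) \<le> m" unfolding m_def using A(1) by (rule cSup_upper)
    then show ?thesis using False by (simp add: blinfun.scaleR_right field_simps)
  qed (simp add: blinfun.zero_right)
  have m: "m > 0"
  proof -
    have "0 < norm (S u0)" using u0 by simp
    also have "\<dots> \<le> m * norm u0" using Sm u0 by simp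
    finally show ?thesis using norm_ge_zero[of u0] by (metis zero_less_mult_pos2 less_eq_real_def mult_zero_right less_irrefl)
  qed
  have radj: "inner (S u) u' = inner u (S' u')" for u u'
    by (simp add: inner_eq_Re_cinner adj)
  have S'm: "norm (S' y) \<le> m * norm y" for y
  proof -
    have "norm (S' y) * norm (S' y) = inner (S (S' y)) y"
      by (simp add: radj flip: power2_norm_eq_inner power2_eq_square)
    also have "\<dots> \<le> norm (S (S' y)) * norm y" by (rule norm_cauchy_schwarz)
    also have "\<dots> \<le> (m * norm (S' y)) * norm y" by (intro mult_right_mono Sm S'E) simp
    finally have "norm (S' y) * norm (S' y) \<le> (m * norm y) * norm (S' y)" by (simp add: algebra_simps)
    then show ?thesis
      using m by (cases "norm (S' y) = 0") (auto simp: mult_le_cancel_right)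
  qed
  have "\<exists>u. u \<in> E \<and> norm u \<le> 1 \<and> m - inverse (real (Suc n)) < norm (S u)" for n
  proof -
    have "m - inverse (real (Suc n)) < Sup A" by (simp add: m_def)
    then obtain a where "a \<in> A" "m - inverse (real (Suc n)) < a" using less_cSupD[OF A(2)] by blast
    then show ?thesis by (auto simp: A_def)
  qed
  then obtain u where u: "\<And>n. u n \<in> E" "\<And>n. norm (u n) \<le> 1" "\<And>n. m - inverse (real (Suc n)) < norm (S (u n))" by metis
  have lim: "(\<lambda>n. norm (S (u n))) \<longlonglongrightarrow> m"
  proof (rule tendsto_sandwich)
    show "(\<lambda>n. m - inverse (real (Suc n))) \<longlonglongrightarrow> m"
      using tendsto_diff[OF tendsto_const[of m] LIMSEQ_inverse_real_of_nat] by simp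
    have "norm (S (u n)) \<le> m" for n
      using Sm[OF u(1), of n] u(2)[of n] m by (meson mult_left_le order_trans less_imp_le)
    then show "\<forall>\<^sub>F n in sequentially. norm (S (u n)) \<le> m" by simp
  qed (use u(3) in \<open>auto intro!: always_eventually less_imp_le\<close>)
  have "S (u n) \<in> closure (S ` cball 0 1)" for n
    using u(2) by (intro subsetD[OF closure_subset]) auto
  then obtain y r where r: "strict_mono (r :: nat \<Rightarrow> nat)" and y: "((\<lambda>n. S (u n)) \<circ> r) \<longlonglongrightarrow> y"
    using cpt unfolding compact_def by (metis (no_types, lifting))
  have sq: "(norm (S' (S (u n)) - m\<^sup>2 *\<^sub>R u n))\<^sup>2 \<le> m\<^sup>2 * (m\<^sup>2 - (norm (S (u n)))\<^sup>2)" for n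
  proof -
    have "(norm (S' (S (u n)) - m\<^sup>2 *\<^sub>R u n))\<^sup>2 =
        (norm (S' (S (u n))))\<^sup>2 - 2 * m\<^sup>2 * inner (u n) (S' (S (u n))) + (m\<^sup>2)\<^sup>2 * (norm (u n))\<^sup>2"
      unfolding power2_norm_eq_inner
      by (simp add: inner_diff_left inner_diff_right inner_commute power2_eq_square algebra_simps)
    also have "inner (u n) (S' (S (u n))) = (norm (S (u n)))\<^sup>2"
      by (simp add: power2_norm_eq_inner flip: radj)
    also have "(norm (S' (S (u n))))\<^sup>2 \<le> (m * norm (S (u n)))\<^sup>2" by (intro power_mono S'm) simp
    also have "(m\<^sup>2)\<^sup>2 * (norm (u n))\<^sup>2 \<le> (m\<^sup>2)\<^sup>2 * 1" using u(2) by (intro mult_left_mono) (auto simp: power_le_one)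
    finally show ?thesis by (simp add: algebra_simps power2_eq_square)
  qed
  have "(\<lambda>n. (norm (S' (S (u n)) - m\<^sup>2 *\<^sub>R u n))\<^sup>2) \<longlonglongrightarrow> 0"
  proof (rule tendsto_sandwich[OF always_eventually always_eventually tendsto_const])
    have "(\<lambda>n. m\<^sup>2 * (m\<^sup>2 - (norm (S (u n)))\<^sup>2)) \<longlonglongrightarrow> m\<^sup>2 * (m\<^sup>2 - m\<^sup>2)"
      by (intro tendsto_intros lim)
    then show "(\<lambda>n. m\<^sup>2 * (m\<^sup>2 - (norm (S (u n)))\<^sup>2)) \<longlonglongrightarrow> 0" by simp
  qed (use sq in simp_all)
  then have "(\<lambda>n. norm (S' (S (u n)) - m\<^sup>2 *\<^sub>R u n)) \<longlonglongrightarrow> 0"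
    using tendsto_real_sqrt by fastforce
  then have "(\<lambda>n. S' (S (u n)) - m\<^sup>2 *\<^sub>R u n) \<longlonglongrightarrow> 0" by (rule tendsto_norm_zero_cancel)
  then have d0: "(\<lambda>n. S' (S (u (r n))) - m\<^sup>2 *\<^sub>R u (r n)) \<longlonglongrightarrow> 0"
    using LIMSEQ_subseq_LIMSEQ[OF _ r] by (force simp: comp_def)
  have Sl: "(\<lambda>n. S (u (r n))) \<longlonglongrightarrow> y" using y by (simp add: comp_def)
  have S'l: "(\<lambda>n. S' (S (u (r n)))) \<longlonglongrightarrow> S' y" by (intro blinfun.tendsto tendsto_const Sl)
  have "(\<lambda>n. (S' (S (u (r n))) - (S' (S (u (r n))) - m\<^sup>2 *\<^sub>R u (r n))) /\<^sub>R m\<^sup>2) \<longlonglongrightarrow> (S' y - 0) /\<^sub>R m\<^sup>2"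
    by (intro tendsto_intros S'l d0)
  then have ul: "(\<lambda>n. u (r n)) \<longlonglongrightarrow> S' y /\<^sub>R m\<^sup>2" using m by simp
  define z where "z = S' y /\<^sub>R m\<^sup>2"
  have "(\<lambda>n. S (u (r n))) \<longlonglongrightarrow> S z" unfolding z_def by (intro blinfun.tendsto tendsto_const ul)
  then have "S z = y" using Sl LIMSEQ_unique by blast
  then have eig: "S' (S z) = m\<^sup>2 *\<^sub>R z" using m by (simp add: z_def)
  have "norm y = m"
    using tendsto_norm[OF Sl] LIMSEQ_subseq_LIMSEQ[OF lim r] by (auto simp: comp_def intro: LIMSEQ_unique)
  then have z0: "z \<noteq> 0" using m \<open>S z = y\<close> by (auto simp: blinfun.zero_right)
  define W where "W = {u \<in> E. S' (S u) = m\<^sup>2 *\<^sub>R u}"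
  have S_scaleC: "S (c *\<^sub>C x) = c *\<^sub>C S x" for c x
  proof -
    have "cinner (S (c *\<^sub>C x) - c *\<^sub>C S x) t = 0" for t
      by (simp add: cinner.diff_left cinner_scaleC_left adj)
    then have "cinner (S (c *\<^sub>C x) - c *\<^sub>C S x) (S (c *\<^sub>C x) - c *\<^sub>C S x) = 0" by blast
    then show ?thesis by (simp add: cinner_self)
  qed
  have S'_scaleC: "S' (c *\<^sub>C x) = c *\<^sub>C S' x" for c x
  proof -
    have "cinner t (S' (c *\<^sub>C x) - c *\<^sub>C S' x) = 0" for t
      by (simp add: cinner.diff_right cinner_scaleC_right flip: adj)
    then have "cinner (S' (c *\<^sub>C x) - c *\<^sub>C S' x) (S' (c *\<^sub>C x) - c *\<^sub>C S' x) = 0" by blast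
    then show ?thesis by (simp add: cinner_self)
  qed
  have "W = E"
  proof (rule irreducible_repD(3)[OF irr])
    have "closed {u. S' (S u) = m\<^sup>2 *\<^sub>R u}"
      by (intro closed_Collect_eq continuous_intros)
    then have "closed W" unfolding W_def using E(2) by (simp add: Collect_conj_eq closed_Int)
    then show "closed_csubspace W"
      unfolding closed_csubspace_def
      using E(1) rep_csubspace[OF rep]
      by (auto simp: W_def subspace_0 subspace_add blinfun.zero_right blinfun.add_right scaleR_add_right
          S_scaleC S'_scaleC closed_csubspace_def scaleC.scaleR_right)
    show "\<rho> g u \<in> W" if "u \<in> W" for g u
      using that by (auto simp: W_def comm rep_in[OF rep] rep_scaleR[OF rep])
    have "z \<in> W" using eig S'E E(1) by (simp add: W_def z_def subspace_scale)
    then show "W \<noteq> {0}" using z0 by blast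
  qed (auto simp: W_def)
  then show ?thesis by (intro that[of "m\<^sup>2"]) (auto simp: W_def)
qed

lemma mean_rank_one_compact:
  fixes a b :: "'g::group_add \<Rightarrow> 'h::complex_hilbert_space"
  assumes S: "has_mean (\<lambda>x. rank_one (a x) (b x)) S"
  shows "compact (closure (S ` cball 0 1))"
  unfolding compact_eq_totally_bounded
proof (intro conjI allI impI)
  show "complete (closure (S ` cball 0 1))" by (simp add: complete_eq_closed)
  fix e :: real assume e: "e > 0"
  then have e3: "e / 4 > 0" by simp
  then obtain xs where xs: "xs \<noteq> []" "\<forall>x. norm (avg xs (\<lambda>x. rank_one (a x) (b x)) x - S) \<le> e / 4"
    using S unfolding has_mean_def by blast
  define R where "R = avg xs (\<lambda>x. rank_one (a x) (b x)) 0"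
  obtain Z where Z: "compact Z" "\<forall>u. norm u \<le> 1 \<longrightarrow> (\<Sum>x\<leftarrow>xs. rank_one (a x) (b x)) u \<in> Z"
    using rank_one_sum_bounded_image by blast
  define Y where "Y = (*\<^sub>R) (inverse (real (length xs))) ` Z"
  have Y: "compact Y" unfolding Y_def using Z(1) by (rule compact_scaling)
  have RY: "R u \<in> Y" if "norm u \<le> 1" for u
  proof -
    have "R u = (\<Sum>x\<leftarrow>xs. rank_one (a x) (b x)) u /\<^sub>R real (length xs)"
      by (simp add: R_def avg_def blinfun.scaleR_left)
    then show ?thesis unfolding Y_def using Z(2) that by blast
  qed
  obtain k where k: "finite k" "Y \<subseteq> (\<Union>x\<in>k. ball x (e / 4))"
    using Y e3 unfolding compact_eq_totally_bounded by blast
  have "S ` cball 0 1 \<subseteq> (\<Union>x\<in>k. cball x (e / 2))"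
  proof
    fix s assume "s \<in> S ` cball 0 1"
    then obtain u where u: "norm u \<le> 1" "s = S u" by auto
    obtain x where x: "x \<in> k" "dist x (R u) < e / 4" using RY[OF u(1)] k(2) by auto
    have "norm ((R - S) u) \<le> norm (R - S) * norm u" by (rule norm_blinfun)
    also have "\<dots> \<le> e / 4 * 1" using xs(2) u(1) e3 by (intro mult_mono) (auto simp: R_def)
    finally have "dist (R u) s \<le> e / 4" by (simp add: dist_norm blinfun.diff_left u(2))
    then have "dist x s \<le> e / 2" using x(2) dist_triangle[of x s "R u"] by simp
    then show "s \<in> (\<Union>x\<in>k. cball x (e / 2))" using x(1) by auto
  qed
  then have "closure (S ` cball 0 1) \<subseteq> (\<Union>x\<in>k. cball x (e / 2))"
    using k(1) by (intro closure_minimal closed_UN) auto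
  also have "\<dots> \<subseteq> (\<Union>x\<in>k. ball x e)" using e by (intro UN_mono) auto
  finally show "\<exists>k. finite k \<and> closure (S ` cball 0 1) \<subseteq> (\<Union>x\<in>k. ball x e)" using k(1) by blast
qed

context precompact_group
begin

lemma biuc_rep:
  fixes \<rho> :: "'g \<Rightarrow> 'h::complex_hilbert_space \<Rightarrow> 'h"
  assumes rep: "unitary_rep (E, \<rho>)" and v: "v \<in> E"
  shows "biuc (\<lambda>x. \<rho> x v)"
  unfolding biuc_def
proof (intro allI impI)
  fix e :: real assume e: "e > 0"
  define U where "U = (\<lambda>x. \<rho> x v) -` ball v e"
  have "open U" unfolding U_def by (intro open_vimage open_ball rep_continuous[OF rep v])
  moreover have "0 \<in> U" using e by (simp add: U_def rep_zero[OF rep v])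
  ultimately obtain V where V: "open V" "0 \<in> V" "\<forall>t\<in>V. \<forall>b. - b + t + b \<in> U"
    using small_conjugates[of U] by metis
  have "norm (\<rho> (a + t + b) v - \<rho> (a + b) v) \<le> e" if t: "t \<in> V" for a b t
  proof -
    have "a + t + b = (a + b) + (- b + t + b)" by (simp add: add.assoc)
    then have "\<rho> (a + t + b) v = \<rho> (a + b) (\<rho> (- b + t + b) v)"
      using rep_add[OF rep v] by metis
    then have "norm (\<rho> (a + t + b) v - \<rho> (a + b) v) = norm (\<rho> (- b + t + b) v - v)"
      using v by (simp add: rep_norm[OF rep] rep_in[OF rep] subspace_diff[OF rep_subspace[OF rep]] flip: rep_minus[OF rep])
    also have "\<rho> (- b + t + b) v \<in> ball v e" using V(3) t unfolding U_def by blast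
    then have "norm (\<rho> (- b + t + b) v - v) \<le> e" by (simp add: dist_norm norm_minus_commute)
    finally show ?thesis .
  qed
  with V show "\<exists>V. open V \<and> 0 \<in> V \<and> (\<forall>a b. \<forall>t\<in>V. norm (\<rho> (a + t + b) v - \<rho> (a + b) v) \<le> e)"
    by (intro exI[of _ V]) simp
qed

lemma biuc_rank_one:
  fixes a b :: "'g \<Rightarrow> 'h::complex_hilbert_space"
  assumes "biuc a" "\<And>x. norm (a x) \<le> A" "biuc b" "\<And>x. norm (b x) \<le> B"
  shows "biuc (\<lambda>x. rank_one (a x) (b x))"
proof (rule biuc_comp2[OF assms(1,3)])
  show "norm (rank_one (a x) (b x) - rank_one (a y) (b y)) \<le> B * norm (a x - a y) + A * norm (b x - b y)" for x y
    by (rule order_trans[OF norm_rank_one_diff]) (intro add_mono mult_right_mono assms, auto)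
qed

end

locale intertwining = precompact_group \<phi>
  for \<phi> :: "'g::{topological_group_add, t2_space} \<Rightarrow> 'k::{topological_group_add, t2_space}" +
  fixes E F :: "'h::complex_hilbert_space set" and \<rho> \<sigma> :: "'g \<Rightarrow> 'h \<Rightarrow> 'h" and v w :: 'h
    and S S' :: "'h \<Rightarrow>\<^sub>L 'h"
  assumes irr1: "irreducible_rep (E, \<rho>)" and irr2: "irreducible_rep (F, \<sigma>)"
    and v: "v \<in> E" and w: "w \<in> F"
    and S: "has_mean (\<lambda>x. rank_one (\<rho> x v) (\<sigma> x w)) S"
    and S': "has_mean (\<lambda>x. rank_one (\<sigma> x w) (\<rho> x v)) S'"
begin

lemmas rep1 = irreducible_repD(1)[OF irr1]
lemmas rep2 = irreducible_repD(1)[OF irr2]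

lemma swap: "intertwining \<phi> F E \<sigma> \<rho> w v S' S"
  by unfold_locales (fact irr1 irr2 v w S S')+

lemma biuc_kernel: "biuc (\<lambda>x. rank_one (\<rho> x v) (\<sigma> x w))"
  by (rule biuc_rank_one[where A = "norm v" and B = "norm w"])
    (auto simp: biuc_rep[OF rep1 v] biuc_rep[OF rep2 w] rep_norm[OF rep1 v] rep_norm[OF rep2 w])

lemma biuc_kernel_apply: "biuc (\<lambda>x. cinner u (\<rho> x v) *\<^sub>C \<sigma> x w)"
  using biuc_bounded_linear[OF blinfun.bounded_linear_left[of u] biuc_kernel] by (simp add: rank_one_apply)

lemma mean_apply: "has_mean (\<lambda>x. cinner u (\<rho> x v) *\<^sub>C \<sigma> x w) (S u)"
  using has_mean_bounded_linear[OF blinfun.bounded_linear_left[of u] S] by (simp add: rank_one_apply)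

lemma mean_cinner: "has_mean (\<lambda>x. cinner u (\<rho> x v) * cinner (\<sigma> x w) t) (cinner (S u) t)"
  using has_mean_bounded_linear[OF cinner.bounded_linear_left[of t] mean_apply] by (simp add: cinner_scaleC_left)

lemma biuc_cinner: "biuc (\<lambda>x. cinner u (\<rho> x v) * cinner (\<sigma> x w) t)"
  using biuc_bounded_linear[OF cinner.bounded_linear_left[of t] biuc_kernel_apply] by (simp add: cinner_scaleC_left)

lemma range_in: "S u \<in> F"
proof (rule has_mean_closed_convex[OF mean_apply])
  show "closed F" "convex F"
    using rep_closed_space[OF rep2] subspace_imp_convex[OF rep_subspace[OF rep2]] .
  show "cinner u (\<rho> x v) *\<^sub>C \<sigma> x w \<in> F" for x
    using rep_csubspace[OF rep2] rep_in[OF rep2 w] by (simp add: closed_csubspace_def)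
qed

lemma adjoint: "cinner (S u) t = cinner u (S' t)"
proof -
  interpret sw: intertwining \<phi> F E \<sigma> \<rho> w v S' S by (rule swap)
  have "has_mean (\<lambda>x. cnj (cinner t (\<sigma> x w) * cinner (\<rho> x v) u)) (cnj (cinner (S' t) u))"
    by (rule has_mean_bounded_linear[OF bounded_linear_cnj sw.mean_cinner])
  then have "has_mean (\<lambda>x. cinner u (\<rho> x v) * cinner (\<sigma> x w) t) (cinner u (S' t))"
    by (simp add: mult.commute flip: cinner_commute)
  then show ?thesis by (rule has_mean_unique[OF biuc_cinner mean_cinner])
qed

lemma S_scaleC: "S (c *\<^sub>C u) = c *\<^sub>C S u"
  by (rule cinner_eqI) (simp add: adjoint cinner_scaleC_left)

lemma intertwines:
  assumes u: "u \<in> E"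
  shows "S (\<rho> y u) = \<sigma> y (S u)"
proof -
  have mem: "cinner u (\<rho> x v) *\<^sub>C \<sigma> x w \<in> F" for x
    using rep_csubspace[OF rep2] rep_in[OF rep2 w] by (simp add: closed_csubspace_def)
  have "has_mean (\<lambda>x. \<sigma> y (cinner u (\<rho> x v) *\<^sub>C \<sigma> x w)) (\<sigma> y (S u))"
    by (rule has_mean_lipschitz_linear_on[OF mean_apply rep_subspace[OF rep2] rep_closed_space[OF rep2] mem, of _ 1])
      (simp_all add: rep_plus[OF rep2] rep_scaleR[OF rep2] rep_norm[OF rep2])
  also have "(\<lambda>x. \<sigma> y (cinner u (\<rho> x v) *\<^sub>C \<sigma> x w)) = (\<lambda>x. cinner (\<rho> y u) (\<rho> (y + x) v) *\<^sub>C \<sigma> (y + x) w)"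
    using u v w by (simp add: rep_scaleC[OF rep2] rep_in[OF rep2] rep_in[OF rep1] rep_add[OF rep1] rep_add[OF rep2] rep_cinner[OF rep1])
  finally have "has_mean (\<lambda>x. cinner (\<rho> y u) (\<rho> (y + x) v) *\<^sub>C \<sigma> (y + x) w) (\<sigma> y (S u))" .
  from has_mean_translate_left[OF this, of "- y"]
  have "has_mean (\<lambda>x. cinner (\<rho> y u) (\<rho> x v) *\<^sub>C \<sigma> x w) (\<sigma> y (S u))" by (simp flip: add.assoc)
  then show ?thesis by (rule has_mean_unique[OF biuc_kernel_apply mean_apply])
qed

lemma scalar:
  obtains l where "l \<ge> 0" "\<forall>u\<in>E. S' (S u) = l *\<^sub>R u"
proof (rule schur_scalar[OF irr1 adjoint])
  interpret sw: intertwining \<phi> F E \<sigma> \<rho> w v S' S by (rule swap)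
  show "S' u \<in> E" for u by (rule sw.range_in)
  show "S' (S (\<rho> g u)) = \<rho> g (S' (S u))" if "u \<in> E" for g u
    using that by (simp add: intertwines sw.intertwines range_in)
  show "compact (closure (S ` cball 0 1))" by (rule mean_rank_one_compact[OF S])
qed

lemma cinner_S:
  assumes "\<forall>u\<in>E. S' (S u) = l *\<^sub>R u" "u \<in> E" "u' \<in> E"
  shows "cinner (S u) (S u') = l *\<^sub>R cinner u u'"
  using assms by (simp add: adjoint cinner_scaleR_right)

lemma norm_S:
  assumes "\<forall>u\<in>E. S' (S u) = l *\<^sub>R u" "u \<in> E" "l \<ge> 0"
  shows "norm (S u) = sqrt l * norm u"
proof -
  have "(norm (S u))\<^sup>2 = l * (norm u)\<^sup>2"
    using cinner_S[OF assms(1,2,2)] by (simp add: cinner_self scaleR_conv_of_real flip: of_real_mult of_real_power)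
  then have "(norm (S u))\<^sup>2 = (sqrt l * norm u)\<^sup>2" using assms(3) by (simp add: power_mult_distrib)
  then show ?thesis using assms(3) by (simp add: power2_eq_iff_nonneg)
qed

lemma equiv_if_nonzero:
  assumes "\<exists>u\<in>E. S u \<noteq> 0"
  shows "rep_equiv (E, \<rho>) (F, \<sigma>)"
proof -
  interpret sw: intertwining \<phi> F E \<sigma> \<rho> w v S' S by (rule swap)
  obtain l where l: "l \<ge> 0" "\<forall>u\<in>E. S' (S u) = l *\<^sub>R u" using scalar .
  have l0: "l > 0"
  proof -
    obtain u where "u \<in> E" "S u \<noteq> 0" using assms by blast
    then have "norm (S u) \<noteq> 0" "norm (S u) = sqrt l * norm u" using norm_S[OF l(2) _ l(1)] by auto
    then have "sqrt l \<noteq> 0" by auto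
    then show ?thesis using l(1) by auto
  qed
  define r where "r = sqrt l"
  have r: "r > 0" "r * r = l" using l0 by (auto simp: r_def)
  define T where "T u = S u /\<^sub>R r" for u
  note subE = rep_subspace[OF rep1] and subF = rep_subspace[OF rep2]
  have inj: "inj_on T E"
  proof (rule inj_onI)
    fix x y assume xy: "x \<in> E" "y \<in> E" "T x = T y"
    then have "S' (S x) = S' (S y)" using r by (simp add: T_def)
    then show "x = y" using xy l(2) l0 by simp
  qed
  have img: "T ` E = F"
  proof -
    define W where "W = {y \<in> F. S (S' y) = l *\<^sub>R y}"
    have "closed {y. S (S' y) = l *\<^sub>R y}"
      by (intro closed_Collect_eq continuous_intros)
    then have "closed W" unfolding W_def using rep_closed_space[OF rep2] by (simp add: Collect_conj_eq closed_Int)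
    then have W: "closed_csubspace W"
      unfolding closed_csubspace_def
      using subF rep_csubspace[OF rep2]
      by (auto simp: W_def subspace_0 subspace_add blinfun.zero_right blinfun.add_right scaleR_add_right
          S_scaleC sw.S_scaleC closed_csubspace_def scaleC.scaleR_right)
    have inv: "\<sigma> g y \<in> W" if "y \<in> W" for g y
      using that by (auto simp: W_def intertwines sw.intertwines range_in sw.range_in rep_in[OF rep2] rep_scaleR[OF rep2])
    obtain u where u: "u \<in> E" "S u \<noteq> 0" using assms by blast
    have "S u \<in> W" using u l(2) range_in by (simp add: W_def blinfun.scaleR_right)
    then have "W \<noteq> {0}" using u by blast
    then have "W = F" using irreducible_repD(3)[OF irr2 W inv] by (auto simp: W_def)
    show ?thesis
    proof
      show "T ` E \<subseteq> F" using range_in subF by (auto simp: T_def subspace_scale)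
      show "F \<subseteq> T ` E"
      proof
        fix y assume "y \<in> F"
        then have "S (S' y) = l *\<^sub>R y" using \<open>W = F\<close> by (auto simp: W_def)
        then have "T (S' y /\<^sub>R r) = (inverse (r * r) * l) *\<^sub>R y"
          by (simp add: T_def blinfun.scaleR_right)
        then have "y = T (S' y /\<^sub>R r)" using l0 unfolding r(2) by simp
        moreover have "S' y /\<^sub>R r \<in> E" using sw.range_in subE by (simp add: subspace_scale)
        ultimately show "y \<in> T ` E" by blast
      qed
    qed
  qed
  have "unitary_map E F T"
    unfolding unitary_map_def
  proof (intro conjI ballI allI)
    show "bij_betw T E F" using inj img by (simp add: bij_betw_def)
    show "T (x + y) = T x + T y" for x y by (simp add: T_def blinfun.add_right scaleR_add_right)
    show "T (c *\<^sub>C x) = c *\<^sub>C T x" for c x by (simp add: T_def S_scaleC scaleC.scaleR_right)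
    show "cinner (T x) (T y) = cinner x y" if "x \<in> E" "y \<in> E" for x y
    proof -
      have "cinner (T x) (T y) = (inverse (r * r) * l) *\<^sub>R cinner x y"
        by (simp only: T_def cinner_scaleR_left cinner_scaleR_right cinner_S[OF l(2) that]) simp
      then show ?thesis using l0 unfolding r(2) by simp
    qed
  qed
  moreover have "T (\<rho> g u) = \<sigma> g (T u)" if "u \<in> E" for g u
    using that by (simp add: T_def intertwines rep_scaleR[OF rep2] range_in)
  ultimately show ?thesis unfolding rep_equiv_def by auto
qed

end

subsection \<open>Equicontinuity of irreducible representations\<close>

lemma pos_funE:
  fixes \<sigma> :: "'g::topological_group_add \<Rightarrow> 'h::complex_hilbert_space \<Rightarrow> 'h"
  assumes "h \<in> pos_fun (F, \<sigma>)"
  obtains n w where "\<forall>i<(n::nat). w i \<in> F" "h = (\<lambda>x. \<Sum>i<n. cinner (\<sigma> x (w i)) (w i))"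
proof -
  obtain n p where p: "h = (\<lambda>g. \<Sum>i<(n::nat). p i g)" "\<forall>i<n. p i \<in> pos_fun' (F, \<sigma>)"
    using assms unfolding pos_fun_def by blast
  have "\<forall>i. \<exists>w. i < n \<longrightarrow> w \<in> F \<and> p i = (\<lambda>g. cinner (\<sigma> g w) w)"
    using p(2) unfolding pos_fun'_def by auto
  then obtain w where w: "\<forall>i. i < n \<longrightarrow> w i \<in> F \<and> p i = (\<lambda>g. cinner (\<sigma> g (w i)) (w i))" by metis
  then show ?thesis using p(1) by (intro that[of n w]) auto
qed

context precompact_group
begin

context
  fixes F :: "'h::complex_hilbert_space set" and \<sigma> :: "'g \<Rightarrow> 'h \<Rightarrow> 'h" and f :: "'g \<Rightarrow> real"
    and w t :: 'h
  assumes rep: "unitary_rep (F, \<sigma>)" and w: "w \<in> F"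
    and f: "biuc f" "\<And>x. 0 \<le> f x" "\<And>x. f x \<le> 1"
    and t: "has_mean (\<lambda>x. f x *\<^sub>R \<sigma> x w) t"
begin

lemma smoothing_mem: "t \<in> F"
  using has_mean_closed_convex[OF t rep_closed_space[OF rep] subspace_imp_convex[OF rep_subspace[OF rep]]]
    rep_in[OF rep w] by (simp add: subspace_scale[OF rep_subspace[OF rep]])

lemma smoothing_norm: "norm t \<le> norm w"
  using has_mean_norm_le[OF t, of "norm w"] f(2,3) by (simp add: rep_norm[OF rep w] mult_left_le_one_le)

lemma smoothing_translate:
  "has_mean (\<lambda>x. f (- y + x) *\<^sub>R \<sigma> x w) (\<sigma> y t)"
  "biuc (\<lambda>x. f (- y + x) *\<^sub>R \<sigma> x w)"
proof -
  have mem: "f x *\<^sub>R \<sigma> x w \<in> F" for x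
    using rep_in[OF rep w] by (simp add: subspace_scale[OF rep_subspace[OF rep]])
  have "has_mean (\<lambda>x. \<sigma> y (f x *\<^sub>R \<sigma> x w)) (\<sigma> y t)"
    by (rule has_mean_lipschitz_linear_on[OF t rep_subspace[OF rep] rep_closed_space[OF rep] mem, of _ 1])
      (simp_all add: rep_plus[OF rep] rep_scaleR[OF rep] rep_norm[OF rep])
  then have "has_mean (\<lambda>x. f x *\<^sub>R \<sigma> (y + x) w) (\<sigma> y t)"
    by (simp add: rep_scaleR[OF rep] rep_in[OF rep w] rep_add[OF rep w])
  from has_mean_translate_left[OF this, of "- y"]
  show "has_mean (\<lambda>x. f (- y + x) *\<^sub>R \<sigma> x w) (\<sigma> y t)" by (simp flip: add.assoc)
  show "biuc (\<lambda>x. f (- y + x) *\<^sub>R \<sigma> x w)"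
    by (rule biuc_bilinear[OF bounded_bilinear_scaleR _ _ biuc_rep[OF rep w], of _ 1 "norm w"])
      (use biuc_translate[OF f(1), of "- y" 0] f in \<open>simp_all add: rep_norm[OF rep w]\<close>)
qed

lemma smoothing_equicontinuous:
  assumes e: "\<And>a b. norm (f (a + - y + b) - f (a + b)) \<le> e"
  shows "norm (\<sigma> y (\<sigma> x t) - \<sigma> x t) \<le> e * norm w"
proof -
  have "norm (\<sigma> (y + x) t - \<sigma> x t) \<le> e * norm w"
  proof (rule has_mean_diff_le[OF smoothing_translate(2,1) smoothing_translate(2,1)])
    fix s
    have "f (- (y + x) + s) - f (- x + s) = f (- x + - y + s) - f (- x + s)" by (simp add: minus_add)
    then have "\<bar>f (- (y + x) + s) - f (- x + s)\<bar> \<le> e" using e[of "- x" s] by simp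
    then show "norm (f (- (y + x) + s) *\<^sub>R \<sigma> s w - f (- x + s) *\<^sub>R \<sigma> s w) \<le> e * norm w"
      by (simp add: rep_norm[OF rep w] mult_right_mono flip: scaleR_diff_left)
  qed
  then show ?thesis by (simp add: rep_add[OF rep smoothing_mem])
qed

lemma smoothing_mean_Re:
  "has_mean (\<lambda>x. f x * Re (cinner (\<sigma> x w) w)) (Re (cinner t w))"
  "biuc (\<lambda>x. f x * Re (cinner (\<sigma> x w) w))"
proof -
  have L: "bounded_linear (\<lambda>s. Re (cinner s w))"
    by (intro bounded_linear_compose[OF bounded_linear_Re] cinner.bounded_linear_left)
  show "has_mean (\<lambda>x. f x * Re (cinner (\<sigma> x w) w)) (Re (cinner t w))"
    using has_mean_bounded_linear[OF L t] by (simp add: cinner_scaleR_left)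
  show "biuc (\<lambda>x. f x * Re (cinner (\<sigma> x w) w))"
    using biuc_bounded_linear[OF L smoothing_translate(2)[of 0]] by (simp add: cinner_scaleR_left)
qed

end

text \<open>
  By Schur's lemma the square of \<open>S u = mean (\<lambda>x. \<langle>u, \<sigma> x z\<rangle> \<sigma> x z)\<close> is a scalar \<open>l\<close>, and the lower bound
  on the mean of the coefficient gives \<open>c \<le> sqrt l\<close>. Since \<open>u = S (S u) / l\<close>, every vector is a mean
  of multiples of translates of \<open>z\<close> and inherits the modulus of continuity of its orbit.
\<close>

lemma uniform_bound_of_smooth_vector:
  fixes F :: "'h::complex_hilbert_space set" and \<sigma> :: "'g \<Rightarrow> 'h \<Rightarrow> 'h"
  assumes irr: "irreducible_rep (F, \<sigma>)" and z: "z \<in> F" "z \<noteq> 0" "norm z \<le> 1"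
    and c: "c > 0" "\<And>m. has_mean (\<lambda>x. (cmod (cinner z (\<sigma> x z)))\<^sup>2) m \<Longrightarrow> c * (norm z)\<^sup>2 \<le> m"
    and e: "\<And>x. norm (\<sigma> y (\<sigma> x z) - \<sigma> x z) \<le> e"
    and u: "u \<in> F"
  shows "norm (\<sigma> y u - u) \<le> e / c * norm u"
proof -
  note rep = irreducible_repD(1)[OF irr]
  have "biuc (\<lambda>x. rank_one (\<sigma> x z) (\<sigma> x z))"
    by (rule biuc_rank_one[where A = "norm z" and B = "norm z"])
      (auto simp: biuc_rep[OF rep z(1)] rep_norm[OF rep z(1)])
  then obtain S where S: "has_mean (\<lambda>x. rank_one (\<sigma> x z) (\<sigma> x z)) S" by (rule has_mean_exists)
  interpret intertwining \<phi> F F \<sigma> \<sigma> z z S S by unfold_locales (fact irr z(1) S)+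
  obtain l where l: "l \<ge> 0" "\<forall>u\<in>F. S (S u) = l *\<^sub>R u" using scalar .
  have e0: "e \<ge> 0" using order_trans[OF norm_ge_zero e] .
  have "has_mean (\<lambda>x. Re (cinner z (\<sigma> x z) * cinner (\<sigma> x z) z)) (Re (cinner (S z) z))"
    by (rule has_mean_bounded_linear[OF bounded_linear_Re mean_cinner])
  moreover have "Re (cinner z (\<sigma> x z) * cinner (\<sigma> x z) z) = (cmod (cinner z (\<sigma> x z)))\<^sup>2" for x
    by (subst (2) cinner_commute) (simp only: complex_norm_square[symmetric] Re_complex_of_real)
  ultimately have "c * (norm z)\<^sup>2 \<le> Re (cinner (S z) z)" using c(2) by simp
  also have "\<dots> \<le> cmod (cinner (S z) z)" by (rule complex_Re_le_cmod)
  also have "\<dots> \<le> norm (S z) * norm z" by (rule cmod_cinner_le)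
  also have "\<dots> = sqrt l * (norm z)\<^sup>2" by (simp add: norm_S[OF l(2) z(1) l(1)] power2_eq_square)
  finally have cl: "c \<le> sqrt l" using z(2) by simp
  then have l0: "sqrt l > 0" using c(1) by linarith
  define p where "p = S u"
  have p: "p \<in> F" using range_in by (simp add: p_def)
  have "norm (\<sigma> y (S p) - S p) \<le> norm p * e"
  proof -
    have "has_mean (\<lambda>x. cinner (\<sigma> y p) (\<sigma> x z) *\<^sub>C \<sigma> x z) (\<sigma> y (S p))"
      using mean_apply[of "\<sigma> y p"] by (simp add: intertwines[OF p])
    from has_mean_translate_left[OF this, of y]
    have 1: "has_mean (\<lambda>x. cinner p (\<sigma> x z) *\<^sub>C \<sigma> (y + x) z) (\<sigma> y (S p))"
      using p by (simp add: rep_add[OF rep z(1)] rep_cinner[OF rep] rep_in[OF rep z(1)])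
    have "biuc (\<lambda>x. cinner (\<sigma> y p) (\<sigma> (y + x + 0) z) *\<^sub>C \<sigma> (y + x + 0) z)"
      by (rule biuc_translate[OF biuc_kernel_apply])
    then have 2: "biuc (\<lambda>x. cinner p (\<sigma> x z) *\<^sub>C \<sigma> (y + x) z)"
      using p by (simp add: rep_add[OF rep z(1)] rep_cinner[OF rep] rep_in[OF rep z(1)])
    show ?thesis
    proof (rule has_mean_diff_le[OF 2 1 biuc_kernel_apply mean_apply])
      fix x
      have "norm (cinner p (\<sigma> x z) *\<^sub>C \<sigma> (y + x) z - cinner p (\<sigma> x z) *\<^sub>C \<sigma> x z) =
          cmod (cinner p (\<sigma> x z)) * norm (\<sigma> y (\<sigma> x z) - \<sigma> x z)"
        by (simp add: rep_add[OF rep z(1)] norm_scaleC flip: scaleC.diff_right)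
      also have "\<dots> \<le> norm p * e"
      proof (intro mult_mono e)
        have "cmod (cinner p (\<sigma> x z)) \<le> norm p * norm (\<sigma> x z)" by (rule cmod_cinner_le)
        also have "\<dots> \<le> norm p * 1" using z by (intro mult_left_mono) (simp_all add: rep_norm[OF rep])
        finally show "cmod (cinner p (\<sigma> x z)) \<le> norm p" by simp
      qed simp_all
      finally show "norm (cinner p (\<sigma> x z) *\<^sub>C \<sigma> (y + x) z - cinner p (\<sigma> x z) *\<^sub>C \<sigma> x z) \<le> norm p * e" .
    qed
  qed
  moreover have "S p = l *\<^sub>R u" using l(2) u by (simp add: p_def)
  moreover have "\<sigma> y (l *\<^sub>R u) - l *\<^sub>R u = l *\<^sub>R (\<sigma> y u - u)"
    by (simp add: rep_scaleR[OF rep u] scaleR_diff_right)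
  moreover have "norm p = sqrt l * norm u" by (simp add: p_def norm_S[OF l(2) u l(1)])
  ultimately have "(sqrt l * sqrt l) * norm (\<sigma> y u - u) \<le> sqrt l * norm u * e" using l(1) by simp
  then have "sqrt l * (sqrt l * norm (\<sigma> y u - u)) \<le> sqrt l * (norm u * e)" by (simp only: mult.assoc)
  then have "sqrt l * norm (\<sigma> y u - u) \<le> norm u * e" using l0 by (rule mult_left_le_imp_le)
  moreover have "c * norm (\<sigma> y u - u) \<le> sqrt l * norm (\<sigma> y u - u)" using cl by (rule mult_right_mono) simp
  ultimately have "c * norm (\<sigma> y u - u) \<le> norm u * e" by linarith
  then show ?thesis using c(1) by (simp add: field_simps)
qed

lemma exists_large_smoothing:
  fixes F :: "'h::complex_hilbert_space set" and \<sigma> :: "'g \<Rightarrow> 'h \<Rightarrow> 'h" and n :: nat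
  assumes rep: "unitary_rep (F, \<sigma>)" and w: "\<forall>i<n. w i \<in> F"
    and h: "h = (\<lambda>x. \<Sum>i<n. cinner (\<sigma> x (w i)) (w i))" "Re (h 0) > 0"
    and f: "biuc f" "\<And>x. 0 \<le> f x" "\<And>x. f x \<le> 1" "\<And>x. x \<notin> U \<Longrightarrow> f x = 0" "has_mean f m"
    and large: "\<And>x. x \<in> U \<Longrightarrow> Re (h 0) / 2 \<le> Re (h x)"
  obtains i t where "i < n" "w i \<noteq> 0" "has_mean (\<lambda>x. f x *\<^sub>R \<sigma> x (w i)) t" "m / 2 * norm (w i) \<le> norm t"
proof -
  have "\<exists>t. has_mean (\<lambda>x. f x *\<^sub>R \<sigma> x (w i)) t" if "i < n" for i
  proof -
    have wi: "w i \<in> F" using w that by blast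
    have "biuc (\<lambda>x. f x *\<^sub>R \<sigma> x (w i))"
      by (rule biuc_bilinear[OF bounded_bilinear_scaleR f(1) _ biuc_rep[OF rep wi], of 1 "norm (w i)"])
        (use f in \<open>simp_all add: rep_norm[OF rep wi]\<close>)
    then show ?thesis using has_mean_exists by blast
  qed
  then obtain t where t: "\<And>i. i < n \<Longrightarrow> has_mean (\<lambda>x. f x *\<^sub>R \<sigma> x (w i)) (t i)" by metis
  have sm: "has_mean (\<lambda>x. f x * Re (cinner (\<sigma> x (w i)) (w i))) (Re (cinner (t i) (w i)))"
    "biuc (\<lambda>x. f x * Re (cinner (\<sigma> x (w i)) (w i)))" if "i < n" for i
    using smoothing_mean_Re[OF rep _ f(1-3) t[OF that]] w that by simp_all
  have "has_mean (\<lambda>x. \<Sum>i<n. f x * Re (cinner (\<sigma> x (w i)) (w i))) (\<Sum>i<n. Re (cinner (t i) (w i)))"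
    by (rule has_mean_sum) (use sm in auto)
  moreover have "biuc (\<lambda>x. \<Sum>i<n. f x * Re (cinner (\<sigma> x (w i)) (w i)))"
    by (rule biuc_sum) (use sm in auto)
  moreover have "(\<Sum>i<n. f x * Re (cinner (\<sigma> x (w i)) (w i))) = f x * Re (h x)" for x
    by (simp add: h(1) sum_distrib_left)
  ultimately have fh: "has_mean (\<lambda>x. f x * Re (h x)) (\<Sum>i<n. Re (cinner (t i) (w i)))" "biuc (\<lambda>x. f x * Re (h x))"
    by simp_all
  have L: "bounded_linear (\<lambda>r :: real. r * (Re (h 0) / 2))" by (rule bounded_linear_mult_left)
  have "f x * (Re (h 0) / 2) \<le> f x * Re (h x)" for x
    using mult_left_mono[OF large f(2)[of x]] f(4)[of x] by (cases "x \<in> U") simp_all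
  then have "m * (Re (h 0) / 2) \<le> (\<Sum>i<n. Re (cinner (t i) (w i)))"
    by (rule has_mean_mono[OF biuc_bounded_linear[OF L f(1)] has_mean_bounded_linear[OF L f(5)] fh(2,1)])
  moreover have h0: "Re (h 0) = (\<Sum>i<n. (norm (w i))\<^sup>2)"
    using w by (simp add: h(1) rep_zero[OF rep] cinner_self)
  ultimately have ge: "(\<Sum>i<n. m / 2 * (norm (w i))\<^sup>2) \<le> (\<Sum>i<n. Re (cinner (t i) (w i)))"
    unfolding sum_distrib_left[symmetric] by simp
  have "\<exists>i<n. w i \<noteq> 0 \<and> m / 2 * (norm (w i))\<^sup>2 \<le> Re (cinner (t i) (w i))"
  proof (rule ccontr)
    assume "\<not> ?thesis"
    then have less: "Re (cinner (t i) (w i)) < m / 2 * (norm (w i))\<^sup>2" if "i < n" "w i \<noteq> 0" for i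
      using that by (meson not_less)
    have "\<exists>i<n. w i \<noteq> 0"
    proof (rule ccontr)
      assume "\<not> ?thesis"
      then have "Re (h 0) = 0" by (simp add: h0)
      then show False using h(2) by simp
    qed
    then have "\<exists>i\<in>{..<n}. Re (cinner (t i) (w i)) < m / 2 * (norm (w i))\<^sup>2" using less by auto
    moreover have "\<forall>i\<in>{..<n}. Re (cinner (t i) (w i)) \<le> m / 2 * (norm (w i))\<^sup>2"
    proof
      fix i assume "i \<in> {..<n}"
      then show "Re (cinner (t i) (w i)) \<le> m / 2 * (norm (w i))\<^sup>2"
        using less[of i] by (cases "w i = 0") (auto simp: cinner.zero_right)
    qed
    ultimately have "(\<Sum>i<n. Re (cinner (t i) (w i))) < (\<Sum>i<n. m / 2 * (norm (w i))\<^sup>2)"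
      by (intro sum_strict_mono_ex1) auto
    then show False using ge by simp
  qed
  then obtain i where i: "i < n" "w i \<noteq> 0" "m / 2 * (norm (w i))\<^sup>2 \<le> Re (cinner (t i) (w i))" by blast
  have "m / 2 * (norm (w i))\<^sup>2 \<le> norm (t i) * norm (w i)"
    using i(3) complex_Re_le_cmod cmod_cinner_le by (meson order_trans)
  then have "m / 2 * norm (w i) \<le> norm (t i)" using i(2) by (simp add: power2_eq_square flip: mult.assoc)
  then show ?thesis using that i t by blast
qed

lemma equicontinuity:
  assumes U: "open U" "(0::'g) \<in> U" and th: "th > 0"
  obtains V where "open V" "0 \<in> V"
    "\<forall>F (\<sigma> :: 'g \<Rightarrow> 'h::complex_hilbert_space \<Rightarrow> 'h). irreducible_rep (F, \<sigma>) \<longrightarrow>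
      (\<forall>h\<in>pos_fun (F, \<sigma>). Re (h 0) > 0 \<longrightarrow> (\<forall>x\<in>U. Re (h 0) / 2 \<le> Re (h x)) \<longrightarrow>
        (\<forall>y\<in>V. \<forall>u\<in>F. norm (\<sigma> y u - u) \<le> th * norm u))"
proof -
  obtain f :: "'g \<Rightarrow> real" where f: "biuc f" "f 0 = 1" "\<And>x. 0 \<le> f x" "\<And>x. f x \<le> 1" "\<And>x. x \<notin> U \<Longrightarrow> f x = 0"
    using bump_function[OF U] by metis
  obtain m where m: "has_mean f m" using has_mean_exists[OF f(1)] .
  have m0: "m > 0"
  proof -
    obtain V where V: "open V" "0 \<in> V" "\<forall>v\<in>V. \<forall>x. norm (f (x + v) - f x) \<le> 1 / 2"
      using biuc_continuous[OF f(1), of "1 / 2"] by (metis half_gt_zero zero_less_one)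
    obtain k :: real where k: "k > 0"
      "\<And>f a c. has_mean f c \<Longrightarrow> (\<And>x. 0 \<le> f x) \<Longrightarrow> (\<And>x. x \<in> V \<Longrightarrow> a \<le> f x) \<Longrightarrow> a \<ge> 0 \<Longrightarrow> k * a \<le> c"
      using mean_ge_on_nbhd[OF V(1,2)] by metis
    have "1 / 2 \<le> f x" if "x \<in> V" for x
    proof -
      have "\<bar>f x - 1\<bar> \<le> 1 / 2" using V(3)[rule_format, OF that, of 0] f(2) by simp
      from abs_le_D2[OF this] show ?thesis by simp
    qed
    then have "k * (1 / 2) \<le> m" using k(2)[OF m f(3), of "1 / 2"] by simp
    then show ?thesis using k(1) by linarith
  qed
  then have m4: "m / 4 > 0" by simp
  obtain V1 where V1: "open V1" "0 \<in> V1" "\<forall>v\<in>V1. \<forall>a b. norm (f (a + v + b) - f (a + b)) \<le> m / 4"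
    using biucD[OF f(1) m4] .
  define V1' where "V1' = uminus -` V1"
  have V1': "open V1'" "0 \<in> V1'" using V1(1,2) by (auto simp: V1'_def intro!: open_vimage continuous_intros)
  obtain k :: real where k: "k > 0"
    "\<And>f a c. has_mean f c \<Longrightarrow> (\<And>x. 0 \<le> f x) \<Longrightarrow> (\<And>x. x \<in> V1' \<Longrightarrow> a \<le> f x) \<Longrightarrow> a \<ge> 0 \<Longrightarrow> k * a \<le> c"
    using mean_ge_on_nbhd[OF V1'] by metis
  define c where "c = k * (m / 4)\<^sup>2"
  have c: "c > 0" using k(1) m4 by (simp add: c_def)
  have thc: "th * c > 0" using th c by simp
  obtain V2 where V2: "open V2" "0 \<in> V2" "\<forall>v\<in>V2. \<forall>a b. norm (f (a + v + b) - f (a + b)) \<le> th * c"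
    using biucD[OF f(1) thc] .
  define V where "V = uminus -` V2"
  have V: "open V" "0 \<in> V" using V2(1,2) by (auto simp: V_def intro!: open_vimage continuous_intros)
  have "norm (\<sigma> y u - u) \<le> th * norm u"
    if irr: "irreducible_rep (F, \<sigma>)" and h: "h \<in> pos_fun (F, \<sigma>)"
      "Re (h 0) > 0" "\<And>x. x \<in> U \<Longrightarrow> Re (h 0) / 2 \<le> Re (h x)" and y: "y \<in> V" and u: "u \<in> F"
    for F and \<sigma> :: "'g \<Rightarrow> 'h::complex_hilbert_space \<Rightarrow> 'h" and h y u
  proof -
    obtain n w where w: "\<forall>i<(n::nat). w i \<in> F" "h = (\<lambda>x. \<Sum>i<n. cinner (\<sigma> x (w i)) (w i))"
      using pos_funE[OF h(1)] .
    note rep = irreducible_repD(1)[OF irr]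
    obtain i t where it: "i < n" "w i \<noteq> 0" "has_mean (\<lambda>x. f x *\<^sub>R \<sigma> x (w i)) t" "m / 2 * norm (w i) \<le> norm t"
      using exists_large_smoothing[OF rep w h(2) f(1,3,4,5) m h(3)] by blast
    have wi: "w i \<in> F" using w(1) it(1) by blast
    define z where "z = t /\<^sub>R norm (w i)"
    have tF: "t \<in> F" by (rule smoothing_mem[OF rep wi f(1,3,4) it(3)])
    then have zF: "z \<in> F" by (simp add: z_def subspace_scale[OF rep_subspace[OF rep]])
    have z1: "norm z \<le> 1"
      using smoothing_norm[OF rep wi f(1,3,4) it(3)] it(2) by (simp add: z_def field_simps)
    have zm: "m / 2 \<le> norm z" using it(2,4) by (simp add: z_def field_simps)
    then have z0: "z \<noteq> 0" using m0 by auto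
    have cont: "norm (\<sigma> y (\<sigma> x z) - \<sigma> x z) \<le> e"
      if "\<And>a b. norm (f (a + - y + b) - f (a + b)) \<le> e" for e x y
    proof -
      have "\<sigma> y (\<sigma> x z) - \<sigma> x z = (\<sigma> y (\<sigma> x t) - \<sigma> x t) /\<^sub>R norm (w i)"
        by (simp add: z_def rep_scaleR[OF rep] tF rep_in[OF rep] scaleR_diff_right)
      then have "norm (\<sigma> y (\<sigma> x z) - \<sigma> x z) = norm (\<sigma> y (\<sigma> x t) - \<sigma> x t) / norm (w i)"
        by (simp add: divide_inverse_commute)
      then show ?thesis
        using smoothing_equicontinuous[OF rep wi f(1,3,4) it(3) that, of x] it(2)
        by (simp add: pos_divide_le_eq)
    qed
    have "norm (\<sigma> y u - u) \<le> th * c / c * norm u"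
    proof (rule uniform_bound_of_smooth_vector[OF irr zF z0 z1 c _ _ u])
      show "norm (\<sigma> y (\<sigma> x z) - \<sigma> x z) \<le> th * c" for x
        using V2(3) y by (intro cont) (auto simp: V_def)
      fix q assume q: "has_mean (\<lambda>x. (cmod (cinner z (\<sigma> x z)))\<^sup>2) q"
      have "(norm z * (m / 4))\<^sup>2 \<le> (cmod (cinner z (\<sigma> x z)))\<^sup>2" if "x \<in> V1'" for x
      proof (rule power_mono)
        have "norm (\<sigma> x (\<sigma> 0 z) - \<sigma> 0 z) \<le> m / 4"
          using V1(3) that by (intro cont) (auto simp: V1'_def)
        then have 1: "norm (z - \<sigma> x z) \<le> m / 4" by (simp add: rep_zero[OF rep zF] norm_minus_commute)
        have "(norm z)\<^sup>2 = cmod (cinner z z)" by (simp add: cinner_self norm_power)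
        also have "cinner z z = cinner z (\<sigma> x z) + cinner z (z - \<sigma> x z)" by (simp add: cinner.diff_right)
        also have "cmod \<dots> \<le> cmod (cinner z (\<sigma> x z)) + norm z * (m / 4)"
          using order_trans[OF cmod_cinner_le mult_left_mono[OF 1]] by (intro norm_triangle_mono) auto
        finally have "norm z * norm z \<le> cmod (cinner z (\<sigma> x z)) + norm z * (m / 4)" by (simp add: power2_eq_square)
        moreover have "norm z * (m / 2) \<le> norm z * norm z" using zm by (rule mult_left_mono) simp
        ultimately show "norm z * (m / 4) \<le> cmod (cinner z (\<sigma> x z))" by simp
      qed (use m0 in simp)
      then have "k * (norm z * (m / 4))\<^sup>2 \<le> q" by (intro k(2)[OF q]) auto
      then show "c * (norm z)\<^sup>2 \<le> q" by (simp only: c_def power_mult_distrib mult_ac)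
    qed
    then show ?thesis using c by simp
  qed
  then show ?thesis by (intro that[OF V]) blast
qed

end

subsection \<open>Isolating an irreducible representation\<close>

lemma compact_insert_limit:
  fixes A :: "nat \<Rightarrow> 'a::topological_space set"
  assumes fin: "\<And>n. finite (A n)"
    and lim: "\<And>W. open W \<Longrightarrow> a \<in> W \<Longrightarrow> \<exists>N. \<forall>n\<ge>N. A n \<subseteq> W"
  shows "compact (insert a (\<Union>n. A n))"
proof (rule compactI)
  fix C assume C: "\<forall>t\<in>C. open t" "insert a (\<Union>n. A n) \<subseteq> \<Union> C"
  then obtain T where T: "T \<in> C" "a \<in> T" by blast
  then obtain N where N: "\<forall>n\<ge>N. A n \<subseteq> T" using lim C(1) by blast
  have "compact (\<Union>n<N. A n)" using fin by (intro finite_imp_compact) auto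
  moreover have "(\<Union>n<N. A n) \<subseteq> \<Union> C" using C(2) by blast
  ultimately obtain D where D: "D \<subseteq> C" "finite D" "(\<Union>n<N. A n) \<subseteq> \<Union> D"
    using C(1) by (metis compactE)
  have "insert a (\<Union>n. A n) \<subseteq> \<Union> (insert T D)"
  proof
    fix x assume "x \<in> insert a (\<Union>n. A n)"
    then consider "x = a" | n where "n < N" "x \<in> A n" | n where "n \<ge> N" "x \<in> A n" by (auto simp: not_le[symmetric])
    then show "x \<in> \<Union> (insert T D)" using T(2) N D(3) by cases blast+
  qed
  then show "\<exists>C'\<subseteq>C. finite C' \<and> insert a (\<Union>n. A n) \<subseteq> \<Union> C'"
    using D T(1) by (intro exI[of _ "insert T D"]) auto
qed

lemma metrizable_decreasing_nbhds:
  assumes "metrizable_space (euclidean :: 't::topological_space topology)"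
  obtains U :: "nat \<Rightarrow> 't::topological_space set" where "\<And>n. open (U n)" "\<And>n. a \<in> U n" "decseq U"
    "\<And>W. open W \<Longrightarrow> a \<in> W \<Longrightarrow> \<exists>n. U n \<subseteq> W"
proof -
  obtain M :: "'t set" and d where Md: "Metric_space M d" "euclidean = Metric_space.mtopology M d"
    using assms unfolding metrizable_space_def by metis
  interpret Metric_space M d by fact
  have "topspace mtopology = UNIV" unfolding Md(2)[symmetric] by simp
  then have M: "M = UNIV" by simp
  show ?thesis
  proof (rule that[of "\<lambda>n. mball a (inverse (real (Suc n)))"])
    show "open (mball a (inverse (real (Suc n))))" for n
      unfolding open_openin Md(2) by simp
    show "a \<in> mball a (inverse (real (Suc n)))" for n
      unfolding centre_in_mball_iff using M by simp
    show "decseq (\<lambda>n. mball a (inverse (real (Suc n))))"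
      by (intro decseq_SucI mball_subset_concentric le_imp_inverse_le) auto
    fix W assume "open W" "a \<in> W"
    then obtain r where r: "r > 0" "mball a r \<subseteq> W"
      unfolding open_openin Md(2) openin_mtopology by blast
    obtain n where "inverse (real (Suc n)) < r" using reals_Archimedean[OF r(1)] by blast
    then show "\<exists>n. mball a (inverse (real (Suc n))) \<subseteq> W"
      using r(2) mball_subset_concentric by (meson less_imp_le order_trans)
  qed
qed

context precompact_group
begin

lemma biuc_coefficient:
  fixes \<rho> :: "'g \<Rightarrow> 'h::complex_hilbert_space \<Rightarrow> 'h"
  assumes "unitary_rep (E, \<rho>)" "v \<in> E"
  shows "biuc (\<lambda>x. cinner (\<rho> x v) t)"
  by (intro biuc_bounded_linear[OF cinner.bounded_linear_left] biuc_rep[OF assms])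

lemma coefficient_mean_positive:
  fixes \<rho> :: "'g \<Rightarrow> 'h::complex_hilbert_space \<Rightarrow> 'h"
  assumes rep: "unitary_rep (E, \<rho>)" and v: "v \<in> E" "norm v = 1"
  obtains c where "has_mean (\<lambda>x. (cmod (cinner (\<rho> x v) v))\<^sup>2) c" "c > 0"
proof -
  define f where "f x = cinner (\<rho> x v) v" for x
  have f: "biuc f" unfolding f_def by (rule biuc_coefficient[OF rep v(1)])
  have f0: "f 0 = 1" by (simp add: f_def rep_zero[OF rep v(1)] cinner_self v(2))
  have "cmod (f x) \<le> 1" for x
    using cmod_cinner_le[of "\<rho> x v" v] by (simp add: f_def rep_norm[OF rep v(1)] v(2))
  then have "biuc (\<lambda>x. inner (f x) (f x))" by (intro biuc_bilinear[OF bounded_bilinear_inner f _ f])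
  then have "biuc (\<lambda>x. (cmod (f x))\<^sup>2)" by (simp add: power2_norm_eq_inner)
  then obtain c where c: "has_mean (\<lambda>x. (cmod (f x))\<^sup>2) c" by (rule has_mean_exists)
  obtain V where V: "open V" "0 \<in> V" "\<forall>v\<in>V. \<forall>x. norm (f (x + v) - f x) \<le> 1 / 2"
    using biuc_continuous[OF f, of "1 / 2"] by (metis half_gt_zero zero_less_one)
  obtain k :: real where k: "k > 0"
    "\<And>f a c. has_mean f c \<Longrightarrow> (\<And>x. 0 \<le> f x) \<Longrightarrow> (\<And>x. x \<in> V \<Longrightarrow> a \<le> f x) \<Longrightarrow> a \<ge> 0 \<Longrightarrow> k * a \<le> c"
    using mean_ge_on_nbhd[OF V(1,2)] by metis
  have "(1 / 2)\<^sup>2 \<le> (cmod (f x))\<^sup>2" if "x \<in> V" for x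
  proof (rule power_mono)
    have "cmod (f x - 1) \<le> 1 / 2" using V(3)[rule_format, OF that, of 0] f0 by simp
    then show "1 / 2 \<le> cmod (f x)" using norm_triangle_ineq2[of 1 "f x"] by (simp add: norm_minus_commute)
  qed simp
  then have "k * (1 / 2)\<^sup>2 \<le> c" by (intro k(2)[OF c]) auto
  moreover have "k * (1 / 2)\<^sup>2 > 0" using k(1) by simp
  ultimately have "c > 0" by linarith
  then show ?thesis using that c by (simp add: f_def)
qed

lemma inequivalent_far:
  fixes E F :: "'h::complex_hilbert_space set" and \<rho> \<sigma> :: "'g \<Rightarrow> 'h \<Rightarrow> 'h"
  assumes irr: "irreducible_rep (E, \<rho>)" "irreducible_rep (F, \<sigma>)" and ineq: "\<not> rep_equiv (E, \<rho>) (F, \<sigma>)"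
    and v: "v \<in> E" "norm v = 1" and c: "has_mean (\<lambda>x. (cmod (cinner (\<rho> x v) v))\<^sup>2) c"
    and h: "h \<in> pos_fun (F, \<sigma>)" and le: "\<And>x. cmod (cinner (\<rho> x v) v - h x) \<le> e"
  shows "c \<le> e"
proof -
  note rep1 = irreducible_repD(1)[OF irr(1)] and rep2 = irreducible_repD(1)[OF irr(2)]
  obtain n w where w: "\<forall>i<(n::nat). w i \<in> F" "h = (\<lambda>x. \<Sum>i<n. cinner (\<sigma> x (w i)) (w i))"
    using pos_funE[OF h] .
  define f where "f x = cinner (\<rho> x v) v" for x
  have f: "biuc f" unfolding f_def by (rule biuc_coefficient[OF rep1 v(1)])
  have f1: "cmod (f x) \<le> 1" for x
    using cmod_cinner_le[of "\<rho> x v" v] by (simp add: f_def rep_norm[OF rep1 v(1)] v(2))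
  have cnjf: "cinner v (\<rho> x v) = cnj (f x)" for x unfolding f_def by (rule cinner_commute)
  have "has_mean (\<lambda>x. cnj (f x) * cinner (\<sigma> x (w i)) (w i)) 0 \<and> biuc (\<lambda>x. cnj (f x) * cinner (\<sigma> x (w i)) (w i))"
    if "i < n" for i
  proof -
    have wi: "w i \<in> F" using w(1) that by blast
    have b: "biuc (\<lambda>x. rank_one (\<rho> x v) (\<sigma> x (w i)))" "biuc (\<lambda>x. rank_one (\<sigma> x (w i)) (\<rho> x v))"
      by (rule biuc_rank_one[where A = "norm v" and B = "norm (w i)"]
          biuc_rank_one[where A = "norm (w i)" and B = "norm v"];
        simp add: biuc_rep[OF rep1 v(1)] biuc_rep[OF rep2 wi] rep_norm[OF rep1 v(1)] rep_norm[OF rep2 wi])+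
    obtain S S' where SS: "has_mean (\<lambda>x. rank_one (\<rho> x v) (\<sigma> x (w i))) S" "has_mean (\<lambda>x. rank_one (\<sigma> x (w i)) (\<rho> x v)) S'"
      using has_mean_exists[OF b(1)] has_mean_exists[OF b(2)] by metis
    interpret intertwining \<phi> E F \<rho> \<sigma> v "w i" S S' by unfold_locales (fact irr v(1) wi SS)+
    have "S v = 0" using equiv_if_nonzero ineq v(1) by blast
    then show ?thesis using mean_cinner[of v "w i"] biuc_cinner[of v "w i"] by (simp add: cnjf cinner.zero_left)
  qed
  then have "has_mean (\<lambda>x. \<Sum>i<n. cnj (f x) * cinner (\<sigma> x (w i)) (w i)) (\<Sum>i<n. 0)"
    "biuc (\<lambda>x. \<Sum>i<n. cnj (f x) * cinner (\<sigma> x (w i)) (w i))"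
    by (intro has_mean_sum biuc_sum; auto)+
  then have fh: "has_mean (\<lambda>x. cnj (f x) * h x) 0" "biuc (\<lambda>x. cnj (f x) * h x)"
    by (simp_all add: w(2) sum_distrib_left)
  have "has_mean (\<lambda>x. complex_of_real ((cmod (f x))\<^sup>2)) (complex_of_real c)"
    using has_mean_bounded_linear[OF bounded_linear_of_real c] by (simp add: f_def)
  then have ff: "has_mean (\<lambda>x. cnj (f x) * f x) (complex_of_real c)"
    by (simp only: complex_norm_square mult.commute)
  have "biuc (\<lambda>x. cnj (f x) * f x)"
    by (intro biuc_bilinear[OF bounded_bilinear_mult _ _ f, of _ 1 1] biuc_bounded_linear[OF bounded_linear_cnj f])
      (simp_all add: f1)
  then have "cmod (complex_of_real c - 0) \<le> e"
  proof (rule has_mean_diff_le[OF _ ff fh(2,1)])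
    fix x
    have "cmod (cnj (f x) * f x - cnj (f x) * h x) = cmod (f x) * cmod (f x - h x)"
      by (simp add: norm_mult flip: right_diff_distrib)
    also have "\<dots> \<le> 1 * e" using f1 le[of x] by (intro mult_mono) (simp_all add: f_def)
    finally show "cmod (cnj (f x) * f x - cnj (f x) * h x) \<le> e" by simp
  qed
  then show ?thesis by simp
qed

text \<open>
  On \<open>U'\<close> the function \<open>h\<close> is almost \<open>h 0\<close>, so \<open>equicontinuity\<close> applies to it with a modulus that
  does not depend on \<open>h\<close>; a fine finite net of \<open>U\<close> then detects deviations of \<open>h\<close> from \<open>f\<close> on \<open>U\<close>.
\<close>

lemma gap_propagation:
  fixes f :: "'g \<Rightarrow> complex" and U U' :: "'g set"
  assumes U': "open U'" "0 \<in> U'" and f: "biuc f" "f 0 = 1" and near: "\<And>x. x \<in> U' \<Longrightarrow> cmod (f x - 1) \<le> 1 / 8"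
    and e: "0 < e" "e \<le> 1 / 8"
  obtains A where "finite A" "A \<subseteq> U"
    "\<forall>F (\<sigma> :: 'g \<Rightarrow> 'h::complex_hilbert_space \<Rightarrow> 'h). irreducible_rep (F, \<sigma>) \<longrightarrow> (\<forall>h \<in> pos_fun (F, \<sigma>).
      (\<forall>x\<in>U'. cmod (f x - h x) \<le> e) \<longrightarrow> (\<forall>x\<in>A. cmod (f x - h x) < e / 2) \<longrightarrow> (\<forall>x\<in>U. cmod (f x - h x) \<le> e))"
proof -
  have e8: "e / 8 > 0" and e4: "e / 4 > 0" using e by auto
  obtain V1 where V1: "open V1" "0 \<in> V1"
    "\<forall>F (\<sigma> :: 'g \<Rightarrow> 'h \<Rightarrow> 'h). irreducible_rep (F, \<sigma>) \<longrightarrow>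
      (\<forall>h\<in>pos_fun (F, \<sigma>). Re (h 0) > 0 \<longrightarrow> (\<forall>x\<in>U'. Re (h 0) / 2 \<le> Re (h x)) \<longrightarrow>
        (\<forall>y\<in>V1. \<forall>u\<in>F. norm (\<sigma> y u - u) \<le> e / 8 * norm u))"
    using equicontinuity[OF U' e8] .
  obtain V2 where V2: "open V2" "0 \<in> V2" "\<forall>v\<in>V2. \<forall>x. norm (f (x + v) - f x) \<le> e / 4"
    using biuc_continuous[OF f(1) e4] .
  obtain A where A: "finite A" "A \<subseteq> U" "\<forall>x\<in>U. \<exists>a\<in>A. \<exists>u\<in>V1 \<inter> V2. x = a + u"
    using finite_net[of "V1 \<inter> V2" U] V1(1,2) V2(1,2) by (metis IntI open_Int)
  have "cmod (f x - h x) \<le> e"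
    if irr: "irreducible_rep (F, \<sigma>)" and h: "h \<in> pos_fun (F, \<sigma>)" and hU': "\<forall>x\<in>U'. cmod (f x - h x) \<le> e"
      and hA: "\<forall>x\<in>A. cmod (f x - h x) < e / 2" and x: "x \<in> U"
    for F and \<sigma> :: "'g \<Rightarrow> 'h \<Rightarrow> 'h" and h x
  proof -
    note rep = irreducible_repD(1)[OF irr]
    obtain n w where w: "\<forall>i<(n::nat). w i \<in> F" "h = (\<lambda>x. \<Sum>i<n. cinner (\<sigma> x (w i)) (w i))"
      using pos_funE[OF h] .
    have Re_le: "\<bar>Re (f y) - Re (h y)\<bar> \<le> 1 / 8" if "y \<in> U'" for y
      using abs_Re_le_cmod[of "f y - h y"] hU' e(2) that by (fastforce intro: order_trans)
    have h0: "\<bar>1 - Re (h 0)\<bar> \<le> 1 / 8" using Re_le[OF U'(2)] f(2) by simp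
    have "Re (h 0) / 2 \<le> Re (h y)" if "y \<in> U'" for y
    proof -
      have "\<bar>Re (f y) - 1\<bar> \<le> 1 / 8" using abs_Re_le_cmod[of "f y - 1"] near[OF that] by simp
      then show ?thesis using Re_le[OF that] h0 by linarith
    qed
    moreover have "Re (h 0) > 0" using h0 by linarith
    ultimately have small: "norm (\<sigma> y u - u) \<le> e / 8 * norm u" if "y \<in> V1" "u \<in> F" for y u
      using V1(3)[rule_format, OF irr h] that by simp
    obtain a y where ay: "a \<in> A" "y \<in> V1" "y \<in> V2" "x = a + y" using A(3) x by blast
    have "cmod (h x - h a) \<le> (\<Sum>i<n. e / 8 * (norm (w i))\<^sup>2)"
      unfolding w(2) sum_subtractf[symmetric]
    proof (rule sum_norm_le)
      fix i assume "i \<in> {..<n}"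
      then have wi: "w i \<in> F" using w(1) by simp
      have yF: "\<sigma> y (w i) - w i \<in> F" using rep_in[OF rep wi] wi rep_subspace[OF rep] by (simp add: subspace_diff)
      have "cinner (\<sigma> x (w i)) (w i) - cinner (\<sigma> a (w i)) (w i) = cinner (\<sigma> a (\<sigma> y (w i) - w i)) (w i)"
        by (simp add: ay(4) rep_add[OF rep wi] rep_minus[OF rep rep_in[OF rep wi] wi] cinner.diff_left)
      also have "cmod \<dots> \<le> norm (\<sigma> a (\<sigma> y (w i) - w i)) * norm (w i)" by (rule cmod_cinner_le)
      also have "\<dots> \<le> (e / 8 * norm (w i)) * norm (w i)"
        using small[OF ay(2) wi] by (intro mult_right_mono) (simp_all add: rep_norm[OF rep yF])
      finally show "cmod (cinner (\<sigma> x (w i)) (w i) - cinner (\<sigma> a (w i)) (w i)) \<le> e / 8 * (norm (w i))\<^sup>2"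
        by (simp add: power2_eq_square mult.assoc)
    qed
    also have "\<dots> = e / 8 * Re (h 0)"
      using w by (simp add: rep_zero[OF rep] cinner_self sum_distrib_left)
    also have "\<dots> \<le> e / 8 * 2"
    proof (rule mult_left_mono)
      show "Re (h 0) \<le> 2" using h0 by linarith
    qed (use e(1) in simp)
    finally have 1: "cmod (h a - h x) \<le> e / 4" by (simp add: norm_minus_commute)
    have 2: "cmod (f x - f a) \<le> e / 4" using V2(3) ay by simp
    have "f x - h x = (f x - f a) + ((f a - h a) + (h a - h x))" by simp
    then have "cmod (f x - h x) \<le> e / 4 + (e / 2 + e / 4)"
      using norm_triangle_mono[OF 2 norm_triangle_mono[OF less_imp_le[OF hA[rule_format, OF ay(1)]] 1]] by metis
    then show ?thesis by simp
  qed
  then show ?thesis by (intro that[OF A(1,2)]) blast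
qed

lemma isolating_neighbourhood:
  fixes E :: "'h::complex_hilbert_space set" and \<rho> :: "'g \<Rightarrow> 'h \<Rightarrow> 'h"
  assumes metr: "metrizable_space (euclidean :: 'g topology)" and irr: "irreducible_rep (E, \<rho>)"
  obtains v C e where "v \<in> E" "compact C" "e > 0"
    "\<forall>F \<sigma> h. irreducible_rep (F, \<sigma>) \<longrightarrow> h \<in> pos_fun (F, \<sigma>) \<longrightarrow>
      (\<forall>x\<in>C. cmod (cinner (\<rho> x v) v - h x) < e) \<longrightarrow> rep_equiv (E, \<rho>) (F, \<sigma>)"
proof -
  note rep = irreducible_repD(1)[OF irr]
  have subE: "subspace E" by (rule rep_subspace[OF rep])
  obtain v0 where v0: "v0 \<in> E" "v0 \<noteq> 0" using irreducible_repD(2)[OF irr] subspace_0[OF subE] by blast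
  define v where "v = v0 /\<^sub>R norm v0"
  have v: "v \<in> E" "norm v = 1" using v0 subE by (auto simp: v_def subspace_scale)
  define f where "f x = cinner (\<rho> x v) v" for x
  have f: "biuc f" unfolding f_def by (rule biuc_coefficient[OF rep v(1)])
  have f0: "f 0 = 1" by (simp add: f_def rep_zero[OF rep v(1)] cinner_self v(2))
  obtain c where c: "has_mean (\<lambda>x. (cmod (cinner (\<rho> x v) v))\<^sup>2) c" "c > 0"
    using coefficient_mean_positive[OF rep v] .
  define e where "e = min (c / 2) (1 / 8)"
  have e: "0 < e" "e \<le> 1 / 8" "e < c" using c(2) by (auto simp: e_def)
  obtain U0 where U0: "open U0" "0 \<in> U0" "\<forall>v\<in>U0. \<forall>x. norm (f (x + v) - f x) \<le> 1 / 8"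
    using biuc_continuous[OF f, of "1 / 8"] by (metis zero_less_divide_1_iff zero_less_numeral)
  obtain B :: "nat \<Rightarrow> 'g set" where B: "\<And>n. open (B n)" "\<And>n. 0 \<in> B n" "decseq B"
    "\<And>W. open W \<Longrightarrow> 0 \<in> W \<Longrightarrow> \<exists>n. B n \<subseteq> W"
    using metrizable_decreasing_nbhds[OF metr, of 0] by blast
  define U where "U n = (case n of 0 \<Rightarrow> UNIV | Suc m \<Rightarrow> B m \<inter> U0)" for n
  have near: "cmod (f x - 1) \<le> 1 / 8" if "x \<in> U (Suc n)" for x n
    using U0(3)[rule_format, of x 0] that f0 by (simp add: U_def)
  have "\<exists>A. finite A \<and> A \<subseteq> U n \<and> (\<forall>F (\<sigma> :: 'g \<Rightarrow> 'h \<Rightarrow> 'h). irreducible_rep (F, \<sigma>) \<longrightarrow> (\<forall>h \<in> pos_fun (F, \<sigma>).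
      (\<forall>x\<in>U (Suc n). cmod (f x - h x) \<le> e) \<longrightarrow> (\<forall>x\<in>A. cmod (f x - h x) < e / 2) \<longrightarrow> (\<forall>x\<in>U n. cmod (f x - h x) \<le> e)))" for n
  proof -
    have "open (U (Suc n))" "0 \<in> U (Suc n)" using B U0 by (auto simp: U_def)
    moreover have "cmod (f x - 1) \<le> 1 / 8" if "x \<in> U (Suc n)" for x using near[OF that] .
    ultimately show ?thesis
      using gap_propagation[where U = "U n", OF _ _ f f0 _ e(1,2), of "U (Suc n)"] by metis
  qed
  then obtain A where A: "\<And>n. finite (A n)" "\<And>n. A n \<subseteq> U n"
    "\<And>n F (\<sigma> :: 'g \<Rightarrow> 'h \<Rightarrow> 'h) h. irreducible_rep (F, \<sigma>) \<Longrightarrow> h \<in> pos_fun (F, \<sigma>) \<Longrightarrow>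
      (\<forall>x\<in>U (Suc n). cmod (f x - h x) \<le> e) \<Longrightarrow> (\<forall>x\<in>A n. cmod (f x - h x) < e / 2) \<Longrightarrow> (\<forall>x\<in>U n. cmod (f x - h x) \<le> e)"
    by metis
  define C where "C = insert 0 (\<Union>n. A n)"
  have "compact C"
    unfolding C_def
  proof (rule compact_insert_limit[OF A(1)])
    fix W :: "'g set" assume "open W" "0 \<in> W"
    then obtain N where N: "B N \<subseteq> W" using B(4) by blast
    have "A n \<subseteq> W" if nN: "n \<ge> Suc N" for n
    proof -
      obtain m where m: "n = Suc m" "m \<ge> N" using nN by (cases n) auto
      have "U n \<subseteq> B N" using decseqD[OF B(3) m(2)] by (auto simp: U_def m(1))
      then show ?thesis using A(2) N by blast
    qed
    then show "\<exists>N. \<forall>n\<ge>N. A n \<subseteq> W" by blast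
  qed
  moreover have "rep_equiv (E, \<rho>) (F, \<sigma>)"
    if irrF: "irreducible_rep (F, \<sigma>)" and h: "h \<in> pos_fun (F, \<sigma>)" and hC: "\<forall>x\<in>C. cmod (f x - h x) < e / 2" for F \<sigma> h
  proof (rule ccontr)
    assume ineq: "\<not> rep_equiv (E, \<rho>) (F, \<sigma>)"
    note repF = irreducible_repD(1)[OF irrF]
    have "continuous_on UNIV h"
    proof -
      obtain n w where w: "\<forall>i<(n::nat). w i \<in> F" "h = (\<lambda>x. \<Sum>i<n. cinner (\<sigma> x (w i)) (w i))"
        using pos_funE[OF h] .
      show ?thesis unfolding w(2)
        by (intro continuous_on_sum cinner.continuous_on continuous_on_const rep_continuous[OF repF]) (use w(1) in auto)
    qed
    moreover have "continuous_on UNIV f"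
      unfolding f_def by (intro cinner.continuous_on continuous_on_const rep_continuous[OF rep v(1)])
    ultimately have "open {x. cmod (f x - h x) < e}"
      by (intro open_Collect_less continuous_intros)
    moreover have "0 \<in> {x. cmod (f x - h x) < e}" using hC e(1) by (fastforce simp: C_def)
    ultimately obtain N where "B N \<subseteq> {x. cmod (f x - h x) < e}" using B(4) by blast
    then have start: "\<forall>x\<in>U (Suc N). cmod (f x - h x) \<le> e" by (auto simp: U_def less_imp_le)
    have hA: "\<forall>x\<in>A n. cmod (f x - h x) < e / 2" for n using hC by (auto simp: C_def)
    have "\<forall>x\<in>U 0. cmod (f x - h x) \<le> e"
      using start by (rule inc_induct[of 0 "Suc N" "\<lambda>n. \<forall>x\<in>U n. cmod (f x - h x) \<le> e", rotated])
        (use A(3)[OF irrF h _ hA] in auto)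
    then have "\<And>x. cmod (cinner (\<rho> x v) v - h x) \<le> e" by (simp add: U_def f_def)
    from inequivalent_far[OF irr irrF ineq v c(1) h this] show False using e(3) by simp
  qed
  ultimately show ?thesis
    using e(1) v(1) by (intro that[of v C "e / 2"]) (auto simp: f_def)
qed

end

theorem theorem4p1:
  fixes \<phi> :: "'g::{topological_group_add, t2_space} \<Rightarrow> 'k::{topological_group_add, t2_space}"
  assumes compact: "compact (UNIV :: 'k set)"
    and precompact: "topological_group_embedding \<phi>"
    and metrizable: "metrizable_space (euclidean :: 'g topology)"
  shows "fell_topology (dual_object :: ('g, 'h::complex_hilbert_space) rep set set) =
         discrete_topology dual_object"
proof -
  interpret precompact_group \<phi> by unfold_locales (fact compact precompact)+
  let ?R = "{(r, s). irreducible_rep r \<and> irreducible_rep s \<and> rep_equiv r s} :: (('g, 'h) rep \<times> ('g, 'h) rep) set"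
  note equiv = equiv_irreducible_rep[where 'g = 'g and 'h = 'h]
  have isolating: "\<exists>n f C \<epsilon>. (\<forall>i<n. f i \<in> pos_fun_class r) \<and> compact C \<and> \<epsilon> > 0 \<and> fell_nbhd dual_object n f C \<epsilon> \<subseteq> {r}"
    if r: "r \<in> dual_object" for r :: "('g, 'h) rep set"
  proof -
    obtain r0 where "r = ?R `` {r0}" "r0 \<in> {r. irreducible_rep r}"
      using r unfolding dual_object_def by (rule quotientE)
    moreover obtain E \<rho> where "r0 = (E, \<rho>)" by (cases r0)
    ultimately have E: "irreducible_rep (E, \<rho>)" "r = ?R `` {(E, \<rho>)}" by simp_all
    have Er: "(E, \<rho>) \<in> r" unfolding E(2) using equiv_class_self[OF equiv] E(1) by blast
    obtain v C e where v: "v \<in> E" and C: "compact C" "e > 0"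
      "\<forall>F \<sigma> h. irreducible_rep (F, \<sigma>) \<longrightarrow> h \<in> pos_fun (F, \<sigma>) \<longrightarrow>
        (\<forall>x\<in>C. cmod (cinner (\<rho> x v) v - h x) < e) \<longrightarrow> rep_equiv (E, \<rho>) (F, \<sigma>)"
      using isolating_neighbourhood[OF metrizable E(1)] .
    define f where "f = (\<lambda>(i::nat) x. cinner (\<rho> x v) v)"
    have "f 0 \<in> pos_fun' (E, \<rho>)" using v by (auto simp: f_def pos_fun'_def)
    then have "f 0 \<in> pos_fun (E, \<rho>)"
      unfolding pos_fun_def by (intro CollectI exI[of _ "Suc 0"] exI[of _ "\<lambda>_. f 0"]) simp
    then have "\<forall>i<1. f i \<in> pos_fun_class r" using Er by (auto simp: pos_fun_class_def)
    moreover have "fell_nbhd dual_object 1 f C e \<subseteq> {r}"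
    proof
      fix s :: "('g, 'h) rep set" assume "s \<in> fell_nbhd dual_object 1 f C e"
      then obtain h where s: "s \<in> dual_object" "h \<in> pos_fun_class s" "\<forall>x\<in>C. cmod (f 0 x - h x) < e"
        unfolding fell_nbhd_def by auto
      obtain F \<sigma> where F: "(F, \<sigma>) \<in> s" "h \<in> pos_fun (F, \<sigma>)" using s(2) by (auto simp: pos_fun_class_def)
      have "irreducible_rep (F, \<sigma>)"
        using in_quotient_imp_subset[OF equiv s(1)[unfolded dual_object_def]] F(1) by blast
      then have "((E, \<rho>), (F, \<sigma>)) \<in> ?R" using C(3) E(1) F(2) s(3) by (auto simp: f_def)
      then have "r = s"
        using quotient_eq_iff[OF equiv r[unfolded dual_object_def] s(1)[unfolded dual_object_def] Er F(1)] by blast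
      then show "s \<in> {r}" by simp
    qed
    ultimately show ?thesis using C(1,2) by blast
  qed
  have isolated: "\<exists>n f C \<epsilon>. (\<forall>i<n. f i \<in> pos_fun_class r) \<and> compact C \<and> \<epsilon> > 0 \<and> fell_nbhd dual_object n f C \<epsilon> \<subseteq> U"
    if "r \<in> U" "U \<subseteq> dual_object" for r and U :: "('g, 'h) rep set set"
  proof -
    have "r \<in> dual_object" "{r} \<subseteq> U" using that by auto
    then show ?thesis using isolating by (meson order_trans)
  qed
  have "fell_open dual_object U \<longleftrightarrow> U \<subseteq> dual_object" for U :: "('g, 'h) rep set set"
    unfolding fell_open_def using isolated[of _ U] by (intro iffI conjI ballI) simp_all
  then show ?thesis by (simp add: topology_eq openin_fell_topology)
qed

end
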